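(* Let $c_1,c_2\in K$ with $c_1c_2(c_1^6-c_2^6)\neq 0$, and let $X_1,X_2,X_3\subset\mathbf{P}^8$ be the three pieces of the $6\times6$ Pfaffian locus attached to $(c_1,c_2,0,0)$. Then each $X_i$ is a ruled surface over the (reducible) plane cubic curve $xyz=0$.
   Context: $K$ is an algebraically closed field of characteristic different from $2$ and $3$; $z_1,\dots,z_9$ are homogeneous coordinates on $\mathbf{P}^8$. The Pfaffian locus is the zero locus of the $6\times 6$ Pfaffians of the $9\times9$ skew-symmetric matrix with $(i,j)$ entry $-\sum_kv_{ijk}z_k$, where $v_{ijk}$ are the alternating coefficients of $c_1h_1+c_2h_2$, with $h_1=a_1\wedge a_2\wedge a_3+a_4\wedge a_5\wedge a_6+a_7\wedge a_8\wedge a_9$ and $h_2=a_1\wedge a_4\wedge a_7+a_2\wedge a_5\wedge a_8+a_3\wedge a_6\wedge a_9$. It decomposes as $X_1\cup X_2\cup X_3$ with $X_1,X_2,X_3$ contained in the linear subspaces $\{z_1=z_6=z_8=0\}$, $\{z_3=z_5=z_7=0\}$, $\{z_2=z_4=z_9=0\}$ respectively. Explicitly, $X_1$ is the union of the three quadric surfaces $\{z_8=z_7=z_6=z_2=z_1=0,\ c_2^2z_4z_5-c_1^2z_3z_9=0\}$, $\{z_9=z_8=z_6=z_5=z_1=0,\ c_2^2z_2z_3-c_1^2z_4z_7=0\}$, $\{z_8=z_6=z_4=z_3=z_1=0,\ c_2^2z_7z_9-c_1^2z_2z_5=0\}$, and the equations of $X_3$ (resp. $X_2$) are obtained from those of $X_1$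 by applying once (resp. twice) the permutation of indices $1\to2\to3\to1$, $4\to5\to6\to4$, $7\to8\to9\to7$. A ruled surface over a curve is the projective bundle ($\mathbf{P}^1$-bundle) associated with a rank $2$ vector bundle on that curve. *)

theory Defs
  imports "HOL-Analysis.Analysis" "HOL-Computational_Algebra.Polynomial"
begin

section \<open>Quasi-projective algebraic sets and regular maps\<close>

text \<open>
  Varieties are sets of closed points of a projective space \<open>\<^bold>P\<^sup>n\<close> over the field \<open>'k\<close>; the index
  type \<open>'n\<close> has \<open>n + 1\<close> elements. A point is the class of its nonzero coordinate vectors.
\<close>

definition hpoint :: "'k::field ^ 'n \<Rightarrow> ('k ^ 'n) set" where
  "hpoint v = {t *s v | t. t \<noteq> 0}"

definition proj_space :: "('k::field ^ 'n) set set" where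
  "proj_space = {hpoint v | v. v \<noteq> 0}"

text \<open>Homogeneous polynomial functions of degree \<open>d\<close> (the zero form included).\<close>

definition form :: "nat \<Rightarrow> ('k::field ^ 'n \<Rightarrow> 'k) \<Rightarrow> bool" where
  "form d F \<longleftrightarrow> (\<exists>S c. finite S \<and> (\<forall>m\<in>S. (\<Sum>i\<in>UNIV. m i) = d) \<and>
     F = (\<lambda>v. \<Sum>m\<in>S. c m * (\<Prod>i\<in>UNIV. (v $ i) ^ (m i :: nat))))"

definition zariski :: "('k::field ^ 'n) set topology" where
  "zariski = topology_generated_by
     {{p \<in> proj_space. \<forall>v\<in>p. F v \<noteq> 0} | F d. form d F}"

definition regular_function :: "('k::field ^ 'n) set set \<Rightarrow> (('k ^ 'n) set \<Rightarrow> 'k) \<Rightarrow> bool" where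
  "regular_function X f \<longleftrightarrow> (\<forall>p\<in>X. \<exists>V d F G.
     openin (subtopology zariski X) V \<and> p \<in> V \<and> form d F \<and> form d G \<and>
     (\<forall>q\<in>V. \<forall>v\<in>q. G v \<noteq> 0 \<and> f q = F v / G v))"

definition regular_map ::
  "('k::field ^ 'n) set set \<Rightarrow> ('k ^ 'm) set set \<Rightarrow> (('k ^ 'n) set \<Rightarrow> ('k ^ 'm) set) \<Rightarrow> bool" where
  "regular_map X Y f \<longleftrightarrow> f \<in> X \<rightarrow> Y \<and> (\<forall>p\<in>X. \<exists>V d F.
     openin (subtopology zariski X) V \<and> p \<in> V \<and> (\<forall>i. form d (F i)) \<and>
     (\<forall>q\<in>V. \<forall>v\<in>q. (\<chi> i. F i v) \<noteq> 0 \<and> f q = hpoint (\<chi> i. F i v)))"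

definition regular_iso ::
  "('k::field ^ 'n) set set \<Rightarrow> ('k ^ 'm) set set \<Rightarrow> (('k ^ 'n) set \<Rightarrow> ('k ^ 'm) set) \<Rightarrow> bool" where
  "regular_iso X Y f \<longleftrightarrow> regular_map X Y f \<and>
     (\<exists>g. regular_map Y X g \<and> (\<forall>x\<in>X. g (f x) = x) \<and> (\<forall>y\<in>Y. f (g y) = y))"

text \<open>Products of varieties are taken via the Segre embedding \<open>([u], [w]) \<mapsto> [u\<^sub>i w\<^sub>j]\<close>.\<close>

definition segre :: "('k::field ^ 'm) set \<Rightarrow> ('k ^ 'n) set \<Rightarrow> ('k ^ ('m \<times> 'n)) set" where
  "segre p q = {\<chi> ij. u $ fst ij * w $ snd ij | u w. u \<in> p \<and> w \<in> q}"

definition segre_prod ::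
  "('k::field ^ 'm) set set \<Rightarrow> ('k ^ 'n) set set \<Rightarrow> ('k ^ ('m \<times> 'n)) set set" where
  "segre_prod X Y = {segre p q | p q. p \<in> X \<and> q \<in> Y}"


section \<open>Vector bundles and their projective bundles\<close>

text \<open>
  A vector bundle of rank \<open>CARD('r)\<close> on \<open>C\<close>, given by a trivialising open cover \<open>U\<close> and the
  transition matrices: \<open>g i j\<close> is regular on \<open>U i \<inter> U j\<close> and takes fibre coordinates over \<open>U j\<close>
  to those over \<open>U i\<close>. The two cocycle conditions make \<open>g i j p\<close> invertible. Since \<open>C\<close> is
  quasi-compact, covers indexed by natural numbers suffice.
\<close>

definition vector_bundle ::
  "('k::field ^ 'm) set set \<Rightarrow> nat set \<Rightarrow> (nat \<Rightarrow> ('k ^ 'm) set set) \<Rightarrow>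
   (nat \<Rightarrow> nat \<Rightarrow> ('k ^ 'm) set \<Rightarrow> 'k ^ 'r ^ 'r) \<Rightarrow> bool" where
  "vector_bundle C I U g \<longleftrightarrow>
     (\<forall>i\<in>I. openin (subtopology zariski C) (U i)) \<and> (\<Union>i\<in>I. U i) = C \<and>
     (\<forall>i\<in>I. \<forall>j\<in>I. \<forall>a b. regular_function (U i \<inter> U j) (\<lambda>p. g i j p $ a $ b)) \<and>
     (\<forall>i\<in>I. \<forall>p\<in>U i. g i i p = mat 1) \<and>
     (\<forall>i\<in>I. \<forall>j\<in>I. \<forall>k\<in>I. \<forall>p\<in>U i \<inter> U j \<inter> U k. g i j p ** g j k p = g i k p)"

text \<open>
  \<open>\<pi> : X \<rightarrow> C\<close> is (isomorphic to) the projective bundle of the vector bundle: \<open>X\<close> is glued from the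
  products \<open>U i \<times> \<^bold>P\<^sup>r\<^sup>-\<^sup>1\<close> along \<open>(p, [w]) \<mapsto> (p, [g i j p w])\<close>.
\<close>

definition is_projective_bundle ::
  "('k::field ^ 'n) set set \<Rightarrow> (('k ^ 'n) set \<Rightarrow> ('k ^ 'm) set) \<Rightarrow> ('k ^ 'm) set set \<Rightarrow>
   nat set \<Rightarrow> (nat \<Rightarrow> ('k ^ 'm) set set) \<Rightarrow>
   (nat \<Rightarrow> nat \<Rightarrow> ('k ^ 'm) set \<Rightarrow> 'k ^ 'r ^ 'r) \<Rightarrow> bool" where
  "is_projective_bundle X \<pi> C I U g \<longleftrightarrow> regular_map X C \<pi> \<and>
     (\<exists>\<psi> :: nat \<Rightarrow> ('k ^ ('m \<times> 'r)) set \<Rightarrow> ('k ^ 'n) set.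
        (\<forall>i\<in>I. regular_iso (segre_prod (U i) proj_space) {x \<in> X. \<pi> x \<in> U i} (\<psi> i) \<and>
           (\<forall>p\<in>U i. \<forall>q\<in>proj_space. \<pi> (\<psi> i (segre p q)) = p)) \<and>
        (\<forall>i\<in>I. \<forall>j\<in>I. \<forall>p\<in>U i \<inter> U j. \<forall>w. w \<noteq> 0 \<longrightarrow>
           \<psi> j (segre p (hpoint w)) = \<psi> i (segre p (hpoint (g i j p *v w)))))"

definition ruled_surface_over ::
  "('k::field ^ 'n) set set \<Rightarrow> ('k ^ 'm) set set \<Rightarrow> bool" where
  "ruled_surface_over X C \<longleftrightarrow>
     (\<exists>\<pi> I U (g :: nat \<Rightarrow> nat \<Rightarrow> ('k ^ 'm) set \<Rightarrow> 'k ^ 2 ^ 2).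
        vector_bundle C I U g \<and> is_projective_bundle X \<pi> C I U g)"

definition triangle_cubic :: "('k::field ^ 3) set set" where
  "triangle_cubic = {p \<in> proj_space. \<forall>v\<in>p. v $ 1 * v $ 2 * v $ 3 = 0}"


section \<open>The Pfaffian locus\<close>

text \<open>Alternating coefficients of \<open>a\<^sub>p \<and> a\<^sub>q \<and> a\<^sub>r\<close>, for distinct \<open>p\<close>, \<open>q\<close>, \<open>r\<close>.\<close>

definition wedge3 :: "nat \<Rightarrow> nat \<Rightarrow> nat \<Rightarrow> nat \<Rightarrow> nat \<Rightarrow> nat \<Rightarrow> 'k::field" where
  "wedge3 p q r i j k =
     (if (i, j, k) \<in> {(p, q, r), (q, r, p), (r, p, q)} then 1
      else if (i, j, k) \<in> {(q, p, r), (p, r, q), (r, q, p)} then - 1 else 0)"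

definition h1 :: "nat \<Rightarrow> nat \<Rightarrow> nat \<Rightarrow> 'k::field" where
  "h1 i j k = wedge3 1 2 3 i j k + wedge3 4 5 6 i j k + wedge3 7 8 9 i j k"

definition h2 :: "nat \<Rightarrow> nat \<Rightarrow> nat \<Rightarrow> 'k::field" where
  "h2 i j k = wedge3 1 4 7 i j k + wedge3 2 5 8 i j k + wedge3 3 6 9 i j k"

definition skew_matrix :: "'k::field \<Rightarrow> 'k \<Rightarrow> 'k ^ 9 \<Rightarrow> nat \<Rightarrow> nat \<Rightarrow> 'k" where
  "skew_matrix c1 c2 z i j = - (\<Sum>k=1..9. (c1 * h1 i j k + c2 * h2 i j k) * z $ of_nat k)"

text \<open>
  \<open>pf M xs\<close> is the Pfaffian of the principal submatrix of \<open>M\<close> on the rows and columns \<open>xs\<close>,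
  by expansion along the first row; it is meant for \<open>xs\<close> of even length.
\<close>

function pf :: "(nat \<Rightarrow> nat \<Rightarrow> 'k::field) \<Rightarrow> nat list \<Rightarrow> 'k" where
  "pf M [] = 1"
| "pf M (x # xs) = (\<Sum>k<length xs. (- 1) ^ k * M x (xs ! k) * pf M (take k xs @ drop (Suc k) xs))"
  by pat_completeness auto
termination by (relation "Wellfounded.measure (\<lambda>(M, xs). length xs)") auto

text \<open>\<open>subseqs [1..<10]\<close> enumerates the strictly increasing lists of indices in \<open>{1..9}\<close>.\<close>

definition pfaffian_locus :: "'k::field \<Rightarrow> 'k \<Rightarrow> ('k ^ 9) set set" where
  "pfaffian_locus c1 c2 = {p \<in> proj_space. \<forall>z\<in>p.
     \<forall>xs\<in>set (subseqs [1..<10]). length xs = 6 \<longrightarrow> pf (skew_matrix c1 c2 z) xs = 0}"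

definition X1 :: "'k::field \<Rightarrow> 'k \<Rightarrow> ('k ^ 9) set set" where
  "X1 c1 c2 = {p \<in> pfaffian_locus c1 c2. \<forall>z\<in>p. z $ 1 = 0 \<and> z $ 6 = 0 \<and> z $ 8 = 0}"

definition X2 :: "'k::field \<Rightarrow> 'k \<Rightarrow> ('k ^ 9) set set" where
  "X2 c1 c2 = {p \<in> pfaffian_locus c1 c2. \<forall>z\<in>p. z $ 3 = 0 \<and> z $ 5 = 0 \<and> z $ 7 = 0}"

definition X3 :: "'k::field \<Rightarrow> 'k \<Rightarrow> ('k ^ 9) set set" where
  "X3 c1 c2 = {p \<in> pfaffian_locus c1 c2. \<forall>z\<in>p. z $ 2 = 0 \<and> z $ 4 = 0 \<and> z $ 9 = 0}"

section \<open>The pieces made explicit\<close>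

text \<open>
  Consistency check of the definitions: each piece is the expected union of three quadric surfaces,
  and the three pieces make up the Pfaffian locus.
\<close>

lemma subseqs6: "filter (\<lambda>xs. length xs = 6) (subseqs [1..<10]) =
    [[1,2,3,4,5,6], [1,2,3,4,5,7], [1,2,3,4,5,8], [1,2,3,4,5,9], [1,2,3,4,6,7], [1,2,3,4,6,8],
     [1,2,3,4,6,9], [1,2,3,4,7,8], [1,2,3,4,7,9], [1,2,3,4,8,9], [1,2,3,5,6,7], [1,2,3,5,6,8],
     [1,2,3,5,6,9], [1,2,3,5,7,8], [1,2,3,5,7,9], [1,2,3,5,8,9], [1,2,3,6,7,8], [1,2,3,6,7,9],
     [1,2,3,6,8,9], [1,2,3,7,8,9], [1,2,4,5,6,7], [1,2,4,5,6,8], [1,2,4,5,6,9], [1,2,4,5,7,8],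
     [1,2,4,5,7,9], [1,2,4,5,8,9], [1,2,4,6,7,8], [1,2,4,6,7,9], [1,2,4,6,8,9], [1,2,4,7,8,9],
     [1,2,5,6,7,8], [1,2,5,6,7,9], [1,2,5,6,8,9], [1,2,5,7,8,9], [1,2,6,7,8,9], [1,3,4,5,6,7],
     [1,3,4,5,6,8], [1,3,4,5,6,9], [1,3,4,5,7,8], [1,3,4,5,7,9], [1,3,4,5,8,9], [1,3,4,6,7,8],
     [1,3,4,6,7,9], [1,3,4,6,8,9], [1,3,4,7,8,9], [1,3,5,6,7,8], [1,3,5,6,7,9], [1,3,5,6,8,9],
     [1,3,5,7,8,9], [1,3,6,7,8,9], [1,4,5,6,7,8], [1,4,5,6,7,9], [1,4,5,6,8,9], [1,4,5,7,8,9],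
     [1,4,6,7,8,9], [1,5,6,7,8,9], [2,3,4,5,6,7], [2,3,4,5,6,8], [2,3,4,5,6,9], [2,3,4,5,7,8],
     [2,3,4,5,7,9], [2,3,4,5,8,9], [2,3,4,6,7,8], [2,3,4,6,7,9], [2,3,4,6,8,9], [2,3,4,7,8,9],
     [2,3,5,6,7,8], [2,3,5,6,7,9], [2,3,5,6,8,9], [2,3,5,7,8,9], [2,3,6,7,8,9], [2,4,5,6,7,8],
     [2,4,5,6,7,9], [2,4,5,6,8,9], [2,4,5,7,8,9], [2,4,6,7,8,9], [2,5,6,7,8,9], [3,4,5,6,7,8],
     [3,4,5,6,7,9], [3,4,5,6,8,9], [3,4,5,7,8,9], [3,4,6,7,8,9], [3,5,6,7,8,9], [4,5,6,7,8,9]]"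
  by code_simp

lemma sum_1_9:
  "(\<Sum>k=1..9. f k) = f 1 + f 2 + f 3 + f 4 + f 5 + f 6 + f 7 + f 8 +
     (f (9::nat) :: 'a::comm_monoid_add)"
  by (simp add: numeral_eq_Suc ac_simps)

lemma skew_matrix_entries:
  "skew_matrix c1 c2 z 1 2 = - c1 * z $ 3" "skew_matrix c1 c2 z 1 3 = c1 * z $ 2"
  "skew_matrix c1 c2 z 1 4 = - c2 * z $ 7" "skew_matrix c1 c2 z 1 5 = 0"
  "skew_matrix c1 c2 z 1 6 = 0" "skew_matrix c1 c2 z 1 7 = c2 * z $ 4"
  "skew_matrix c1 c2 z 1 8 = 0" "skew_matrix c1 c2 z 1 9 = 0"
  "skew_matrix c1 c2 z 2 3 = - c1 * z $ 1" "skew_matrix c1 c2 z 2 4 = 0"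
  "skew_matrix c1 c2 z 2 5 = - c2 * z $ 8" "skew_matrix c1 c2 z 2 6 = 0"
  "skew_matrix c1 c2 z 2 7 = 0" "skew_matrix c1 c2 z 2 8 = c2 * z $ 5"
  "skew_matrix c1 c2 z 2 9 = 0" "skew_matrix c1 c2 z 3 4 = 0"
  "skew_matrix c1 c2 z 3 5 = 0" "skew_matrix c1 c2 z 3 6 = - c2 * z $ 9"
  "skew_matrix c1 c2 z 3 7 = 0" "skew_matrix c1 c2 z 3 8 = 0"
  "skew_matrix c1 c2 z 3 9 = c2 * z $ 6" "skew_matrix c1 c2 z 4 5 = - c1 * z $ 6"
  "skew_matrix c1 c2 z 4 6 = c1 * z $ 5" "skew_matrix c1 c2 z 4 7 = - c2 * z $ 1"
  "skew_matrix c1 c2 z 4 8 = 0" "skew_matrix c1 c2 z 4 9 = 0"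
  "skew_matrix c1 c2 z 5 6 = - c1 * z $ 4" "skew_matrix c1 c2 z 5 7 = 0"
  "skew_matrix c1 c2 z 5 8 = - c2 * z $ 2" "skew_matrix c1 c2 z 5 9 = 0"
  "skew_matrix c1 c2 z 6 7 = 0" "skew_matrix c1 c2 z 6 8 = 0"
  "skew_matrix c1 c2 z 6 9 = - c2 * z $ 3" "skew_matrix c1 c2 z 7 8 = - c1 * z $ 9"
  "skew_matrix c1 c2 z 7 9 = c1 * z $ 8" "skew_matrix c1 c2 z 8 9 = - c1 * z $ 7"
  unfolding skew_matrix_def sum_1_9 h1_def h2_def wedge3_def by simp_all

lemma pf6:
  "pf M [a, b, c, d, e, f] =
     M a b * (M c d * M e f - M c e * M d f + M c f * M d e) -
     M a c * (M b d * M e f - M b e * M d f + M b f * M d e) +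
     M a d * (M b c * M e f - M b e * M c f + M b f * M c e) -
     M a e * (M b c * M d f - M b d * M c f + M b f * M c d) +
     M a f * (M b c * M d e - M b d * M c e + M b e * M c d)"
  by (simp add: numeral_eq_Suc algebra_simps)

lemma pfaffians_zero_iff:
  "(\<forall>xs\<in>set (subseqs [1..<10]). length xs = 6 \<longrightarrow> P xs) \<longleftrightarrow>
   list_all P (filter (\<lambda>xs. length xs = 6) (subseqs [1..<10]))"
  by (auto simp: list_all_iff)

lemmas pfaffian_equations =
  pfaffians_zero_iff[of "\<lambda>xs. pf (skew_matrix c1 c2 z) xs = 0" for c1 c2 z,
    unfolded subseqs6 list.pred_inject pf6 skew_matrix_entries
      mult_zero_left mult_zero_right minus_zero diff_0_right add_0_left add_0_right,
    unfolded mult_zero_left mult_zero_right minus_zero diff_0_right add_0_left add_0_right]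

lemma pfaffians_vanish_cases:
  assumes "c1 \<noteq> 0" "c2 \<noteq> 0" and n: "c1 ^ 3 + c2 ^ 3 \<noteq> 0" "c1 ^ 3 - c2 ^ 3 \<noteq> 0"
    and P: "\<forall>xs\<in>set (subseqs [1..<10]). length xs = 6 \<longrightarrow> pf (skew_matrix c1 c2 z) xs = 0"
  shows "z $ 1 = 0 \<and> z $ 6 = 0 \<and> z $ 8 = 0 \<or> z $ 3 = 0 \<and> z $ 5 = 0 \<and> z $ 7 = 0 \<or>
    z $ 2 = 0 \<and> z $ 4 = 0 \<and> z $ 9 = 0"
proof -
  have "list_all (\<lambda>xs. pf (skew_matrix c1 c2 z) xs = 0)
      (filter (\<lambda>xs. length xs = 6) (subseqs [1..<10]))"
    using P by (auto simp: list_all_iff)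
  then have E: "pf (skew_matrix c1 c2 z) [1,2,3,4,7,8] = 0"
    "pf (skew_matrix c1 c2 z) [1,2,3,5,6,7] = 0"
    "pf (skew_matrix c1 c2 z) [1,2,4,5,7,9] = 0"
    "pf (skew_matrix c1 c2 z) [1,2,5,6,7,9] = 0"
    "pf (skew_matrix c1 c2 z) [1,2,5,6,8,9] = 0"
    "pf (skew_matrix c1 c2 z) [1,2,6,7,8,9] = 0"
    "pf (skew_matrix c1 c2 z) [1,3,4,5,8,9] = 0"
    "pf (skew_matrix c1 c2 z) [1,3,5,6,7,9] = 0"
    "pf (skew_matrix c1 c2 z) [2,3,4,6,7,8] = 0"
    "pf (skew_matrix c1 c2 z) [2,3,4,6,8,9] = 0"
    "pf (skew_matrix c1 c2 z) [2,3,4,7,8,9] = 0"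
    "pf (skew_matrix c1 c2 z) [2,4,6,7,8,9] = 0"
    "pf (skew_matrix c1 c2 z) [3,4,5,7,8,9] = 0"
    unfolding subseqs6 list.pred_inject by blast+
  have "c1 * c1 * c2 * z $ 1 * z $ 7 * z $ 9 = c1 * c2 * c2 * z $ 1 * z $ 2 * z $ 5"
    "c1 * c1 * c2 * z $ 1 * z $ 4 * z $ 4 = c2 * c2 * c2 * z $ 4 * z $ 8 * z $ 9"
    "c1 * c1 * c1 * z $ 3 * z $ 6 * z $ 8 = c1 * c2 * c2 * z $ 7 * z $ 8 * z $ 8"
    "(c1 ^ 3 - c2 ^ 3) * (z $ 3 * z $ 4 * z $ 8) = 0"
    "c1 * c1 * c1 * z $ 3 * z $ 4 * z $ 7 = c1 * c2 * c2 * z $ 2 * z $ 3 * z $ 3"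
    "c1 * c1 * c2 * z $ 3 * z $ 3 * z $ 9 = c2 * c2 * c2 * z $ 3 * z $ 4 * z $ 5"
    "(c1 ^ 3 - c2 ^ 3) * (z $ 2 * z $ 6 * z $ 7) = 0"
    "c1 * c1 * c1 * z $ 2 * z $ 4 * z $ 8 = c1 * c2 * c2 * z $ 4 * z $ 4 * z $ 6"
    "(c1 ^ 3 - c2 ^ 3) * (z $ 1 * z $ 5 * z $ 9) = 0"
    "c1 * c1 * c1 * z $ 1 * z $ 5 * z $ 7 = c1 * c2 * c2 * z $ 5 * z $ 5 * z $ 6"
    "c1 * c1 * c2 * z $ 1 * z $ 1 * z $ 7 = c2 * c2 * c2 * z $ 1 * z $ 5 * z $ 6"
    "c1 * c1 * c2 * z $ 5 * z $ 5 * z $ 8 = c2 * c2 * c2 * z $ 1 * z $ 3 * z $ 5"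
    "c1 * c1 * c2 * z $ 6 * z $ 6 * z $ 9 = c2 * c2 * c2 * z $ 1 * z $ 2 * z $ 6"
    using E[unfolded pf6 skew_matrix_entries] by algebra+
  note F = this[unfolded mult_eq_0_iff, simplified assms(1-4), simplified]
  show ?thesis
    by (use F assms(1,2) in \<open>cases "z $ 1 = 0"; cases "z $ 2 = 0"; cases "z $ 3 = 0";
      cases "z $ 4 = 0"; cases "z $ 5 = 0"; simp; auto\<close>)
qed

lemma pfaffians_vanish_X1:
  assumes c: "c1 \<noteq> 0" "c2 \<noteq> 0" "c1 ^ 3 + c2 ^ 3 \<noteq> 0"
    and z: "z $ 1 = 0" "z $ 6 = 0" "z $ 8 = 0"
  shows "(\<forall>xs\<in>set (subseqs [1..<10]). length xs = 6 \<longrightarrow> pf (skew_matrix c1 c2 z) xs = 0) \<longleftrightarrow>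
    z $ 7 = 0 \<and> z $ 2 = 0 \<and> c2\<^sup>2 * z $ 4 * z $ 5 - c1\<^sup>2 * z $ 3 * z $ 9 = 0 \<or>
    z $ 9 = 0 \<and> z $ 5 = 0 \<and> c2\<^sup>2 * z $ 2 * z $ 3 - c1\<^sup>2 * z $ 4 * z $ 7 = 0 \<or>
    z $ 4 = 0 \<and> z $ 3 = 0 \<and> c2\<^sup>2 * z $ 7 * z $ 9 - c1\<^sup>2 * z $ 2 * z $ 5 = 0"
    (is "?P \<longleftrightarrow> _ \<and> _ \<and> ?q1 = 0 \<or> _ \<and> _ \<and> ?q2 = 0 \<or> _ \<and> _ \<and> ?q3 = 0"
     is "_ \<longleftrightarrow> ?Q")
proof
  assume ?Q
  then show ?P
    unfolding pfaffian_equations z by (elim disjE conjE) (simp, algebra?)+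
next
  assume ?P
  then have "list_all (\<lambda>xs. pf (skew_matrix c1 c2 z) xs = 0)
      (filter (\<lambda>xs. length xs = 6) (subseqs [1..<10]))"
    by (auto simp: list_all_iff)
  then have E: "pf (skew_matrix c1 c2 z) [1,2,3,4,6,8] = 0" "pf (skew_matrix c1 c2 z) [1,2,3,6,7,8] = 0"
    "pf (skew_matrix c1 c2 z) [1,2,4,6,7,8] = 0" "pf (skew_matrix c1 c2 z) [1,2,4,6,8,9] = 0"
    "pf (skew_matrix c1 c2 z) [1,2,5,6,7,8] = 0" "pf (skew_matrix c1 c2 z) [1,2,5,6,8,9] = 0"
    "pf (skew_matrix c1 c2 z) [1,2,6,7,8,9] = 0" "pf (skew_matrix c1 c2 z) [1,3,4,5,6,8] = 0"
    "pf (skew_matrix c1 c2 z) [1,3,4,6,7,8] = 0" "pf (skew_matrix c1 c2 z) [1,3,4,6,8,9] = 0"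
    "pf (skew_matrix c1 c2 z) [1,3,5,6,7,8] = 0" "pf (skew_matrix c1 c2 z) [1,3,5,6,8,9] = 0"
    "pf (skew_matrix c1 c2 z) [1,4,5,6,8,9] = 0" "pf (skew_matrix c1 c2 z) [1,5,6,7,8,9] = 0"
    unfolding subseqs6 list.pred_inject by blast+
  have "c2 * (z $ 5 * ?q3) = 0" "c2 * (z $ 9 * ?q1) = 0" "c1 * (z $ 5 * ?q1) = 0"
    "(c1 ^ 3 + c2 ^ 3) * (z $ 3 * z $ 5 * z $ 7) = 0" "c1 * (z $ 4 * ?q1) = 0" "c1 * (z $ 3 * ?q2) = 0"
    "c2 * (z $ 3 * ?q1) = 0" "c2 * (z $ 2 * ?q3) = 0" "c1 * (z $ 9 * ?q3) = 0"
    "c1 * (z $ 7 * ?q3) = 0" "(c1 ^ 3 + c2 ^ 3) * (z $ 2 * z $ 4 * z $ 9) = 0" "c1 * (z $ 2 * ?q2) = 0"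
    "c2 * (z $ 7 * ?q2) = 0" "c2 * (z $ 4 * ?q2) = 0"
    using E[unfolded pf6 skew_matrix_entries z] by algebra+
  then have F: "z $ 5 * ?q3 = 0" "z $ 9 * ?q1 = 0" "z $ 5 * ?q1 = 0" "z $ 3 * z $ 5 * z $ 7 = 0"
    "z $ 4 * ?q1 = 0" "z $ 3 * ?q2 = 0" "z $ 3 * ?q1 = 0" "z $ 2 * ?q3 = 0"
    "z $ 9 * ?q3 = 0" "z $ 7 * ?q3 = 0" "z $ 2 * z $ 4 * z $ 9 = 0" "z $ 2 * ?q2 = 0"
    "z $ 7 * ?q2 = 0" "z $ 4 * ?q2 = 0"
    using c by auto
  then have "z $ 7 = 0 \<and> z $ 2 = 0 \<or> z $ 9 = 0 \<and> z $ 5 = 0 \<or> z $ 4 = 0 \<and> z $ 3 = 0"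
    using c by (cases "z $ 2 = 0"; cases "z $ 3 = 0"; cases "z $ 4 = 0"; auto)
  moreover have "?q1 = 0" if "z $ 7 = 0 \<and> z $ 2 = 0"
    using F that by (cases "z $ 3 = 0"; cases "z $ 4 = 0"; simp)
  moreover have "?q2 = 0" if "z $ 9 = 0 \<and> z $ 5 = 0"
    using F that by (cases "z $ 3 = 0"; cases "z $ 4 = 0"; simp)
  moreover have "?q3 = 0" if "z $ 4 = 0 \<and> z $ 3 = 0"
    using F that by (cases "z $ 2 = 0"; cases "z $ 7 = 0"; simp)
  ultimately show ?Q
    by blast
qed

lemma pfaffians_vanish_X2:
  assumes c: "c1 \<noteq> 0" "c2 \<noteq> 0" "c1 ^ 3 + c2 ^ 3 \<noteq> 0"
    and z: "z $ 3 = 0" "z $ 5 = 0" "z $ 7 = 0"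
  shows "(\<forall>xs\<in>set (subseqs [1..<10]). length xs = 6 \<longrightarrow> pf (skew_matrix c1 c2 z) xs = 0) \<longleftrightarrow>
    z $ 9 = 0 \<and> z $ 1 = 0 \<and> c2\<^sup>2 * z $ 6 * z $ 4 - c1\<^sup>2 * z $ 2 * z $ 8 = 0 \<or>
    z $ 8 = 0 \<and> z $ 4 = 0 \<and> c2\<^sup>2 * z $ 1 * z $ 2 - c1\<^sup>2 * z $ 6 * z $ 9 = 0 \<or>
    z $ 6 = 0 \<and> z $ 2 = 0 \<and> c2\<^sup>2 * z $ 9 * z $ 8 - c1\<^sup>2 * z $ 1 * z $ 4 = 0"
    (is "?P \<longleftrightarrow> _ \<and> _ \<and> ?q1 = 0 \<or> _ \<and> _ \<and> ?q2 = 0 \<or> _ \<and> _ \<and> ?q3 = 0"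
     is "_ \<longleftrightarrow> ?Q")
proof
  assume ?Q
  then show ?P
    unfolding pfaffian_equations z by (elim disjE conjE) (simp, algebra?)+
next
  assume ?P
  then have "list_all (\<lambda>xs. pf (skew_matrix c1 c2 z) xs = 0)
      (filter (\<lambda>xs. length xs = 6) (subseqs [1..<10]))"
    by (auto simp: list_all_iff)
  then have E: "pf (skew_matrix c1 c2 z) [1,2,3,5,6,7] = 0" "pf (skew_matrix c1 c2 z) [1,2,3,5,7,9] = 0"
    "pf (skew_matrix c1 c2 z) [1,3,4,5,7,8] = 0" "pf (skew_matrix c1 c2 z) [1,3,4,5,7,9] = 0"
    "pf (skew_matrix c1 c2 z) [1,3,5,6,7,8] = 0" "pf (skew_matrix c1 c2 z) [1,3,5,6,7,9] = 0"
    "pf (skew_matrix c1 c2 z) [1,3,5,7,8,9] = 0" "pf (skew_matrix c1 c2 z) [2,3,4,5,6,7] = 0"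
    "pf (skew_matrix c1 c2 z) [2,3,4,5,7,8] = 0" "pf (skew_matrix c1 c2 z) [2,3,4,5,7,9] = 0"
    "pf (skew_matrix c1 c2 z) [2,3,5,6,7,8] = 0" "pf (skew_matrix c1 c2 z) [2,3,5,6,7,9] = 0"
    "pf (skew_matrix c1 c2 z) [3,4,5,6,7,8] = 0" "pf (skew_matrix c1 c2 z) [3,4,5,7,8,9] = 0"
    unfolding subseqs6 list.pred_inject by blast+
  have "c2 * (z $ 4 * ?q3) = 0" "c2 * (z $ 8 * ?q1) = 0" "c1 * (z $ 2 * ?q2) = 0"
    "c1 * (z $ 6 * ?q1) = 0" "(c1 ^ 3 + c2 ^ 3) * (z $ 2 * z $ 4 * z $ 9) = 0" "c1 * (z $ 4 * ?q1) = 0"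
    "c2 * (z $ 2 * ?q1) = 0" "c2 * (z $ 1 * ?q3) = 0" "c1 * (z $ 1 * ?q2) = 0"
    "(c1 ^ 3 + c2 ^ 3) * (z $ 1 * z $ 6 * z $ 8) = 0" "c1 * (z $ 9 * ?q3) = 0" "c1 * (z $ 8 * ?q3) = 0"
    "c2 * (z $ 9 * ?q2) = 0" "c2 * (z $ 6 * ?q2) = 0"
    using E[unfolded pf6 skew_matrix_entries z] by algebra+
  then have F: "z $ 4 * ?q3 = 0" "z $ 8 * ?q1 = 0" "z $ 2 * ?q2 = 0" "z $ 6 * ?q1 = 0"
    "z $ 2 * z $ 4 * z $ 9 = 0" "z $ 4 * ?q1 = 0" "z $ 2 * ?q1 = 0" "z $ 1 * ?q3 = 0"
    "z $ 1 * ?q2 = 0" "z $ 1 * z $ 6 * z $ 8 = 0" "z $ 9 * ?q3 = 0" "z $ 8 * ?q3 = 0"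
    "z $ 9 * ?q2 = 0" "z $ 6 * ?q2 = 0"
    using c by auto
  then have "z $ 9 = 0 \<and> z $ 1 = 0 \<or> z $ 8 = 0 \<and> z $ 4 = 0 \<or> z $ 6 = 0 \<and> z $ 2 = 0"
    using c by (cases "z $ 1 = 0"; cases "z $ 2 = 0"; cases "z $ 6 = 0"; auto)
  moreover have "?q1 = 0" if "z $ 9 = 0 \<and> z $ 1 = 0"
    using F that by (cases "z $ 2 = 0"; cases "z $ 6 = 0"; simp)
  moreover have "?q2 = 0" if "z $ 8 = 0 \<and> z $ 4 = 0"
    using F that by (cases "z $ 2 = 0"; cases "z $ 6 = 0"; simp)
  moreover have "?q3 = 0" if "z $ 6 = 0 \<and> z $ 2 = 0"
    using F that by (cases "z $ 1 = 0"; cases "z $ 9 = 0"; simp)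
  ultimately show ?Q
    by blast
qed

lemma pfaffians_vanish_X3:
  assumes c: "c1 \<noteq> 0" "c2 \<noteq> 0" "c1 ^ 3 + c2 ^ 3 \<noteq> 0"
    and z: "z $ 2 = 0" "z $ 4 = 0" "z $ 9 = 0"
  shows "(\<forall>xs\<in>set (subseqs [1..<10]). length xs = 6 \<longrightarrow> pf (skew_matrix c1 c2 z) xs = 0) \<longleftrightarrow>
    z $ 8 = 0 \<and> z $ 3 = 0 \<and> c2\<^sup>2 * z $ 5 * z $ 6 - c1\<^sup>2 * z $ 1 * z $ 7 = 0 \<or>
    z $ 7 = 0 \<and> z $ 6 = 0 \<and> c2\<^sup>2 * z $ 3 * z $ 1 - c1\<^sup>2 * z $ 5 * z $ 8 = 0 \<or>
    z $ 5 = 0 \<and> z $ 1 = 0 \<and> c2\<^sup>2 * z $ 8 * z $ 7 - c1\<^sup>2 * z $ 3 * z $ 6 = 0"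
    (is "?P \<longleftrightarrow> _ \<and> _ \<and> ?q1 = 0 \<or> _ \<and> _ \<and> ?q2 = 0 \<or> _ \<and> _ \<and> ?q3 = 0"
     is "_ \<longleftrightarrow> ?Q")
proof
  assume ?Q
  then show ?P
    unfolding pfaffian_equations z by (elim disjE conjE) (simp, algebra?)+
next
  assume ?P
  then have "list_all (\<lambda>xs. pf (skew_matrix c1 c2 z) xs = 0)
      (filter (\<lambda>xs. length xs = 6) (subseqs [1..<10]))"
    by (auto simp: list_all_iff)
  then have E: "pf (skew_matrix c1 c2 z) [1,2,3,4,5,9] = 0" "pf (skew_matrix c1 c2 z) [1,2,3,4,8,9] = 0"
    "pf (skew_matrix c1 c2 z) [1,2,4,5,6,9] = 0" "pf (skew_matrix c1 c2 z) [1,2,4,5,7,9] = 0"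
    "pf (skew_matrix c1 c2 z) [1,2,4,5,8,9] = 0" "pf (skew_matrix c1 c2 z) [1,2,4,6,7,9] = 0"
    "pf (skew_matrix c1 c2 z) [1,2,4,6,8,9] = 0" "pf (skew_matrix c1 c2 z) [2,3,4,5,7,9] = 0"
    "pf (skew_matrix c1 c2 z) [2,3,4,5,8,9] = 0" "pf (skew_matrix c1 c2 z) [2,3,4,6,7,9] = 0"
    "pf (skew_matrix c1 c2 z) [2,3,4,6,8,9] = 0" "pf (skew_matrix c1 c2 z) [2,3,4,7,8,9] = 0"
    "pf (skew_matrix c1 c2 z) [2,4,5,6,7,9] = 0" "pf (skew_matrix c1 c2 z) [2,4,6,7,8,9] = 0"
    unfolding subseqs6 list.pred_inject by blast+
  have "c2 * (z $ 6 * ?q3) = 0" "c2 * (z $ 7 * ?q1) = 0" "c2 * (z $ 3 * ?q3) = 0"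
    "c1 * (z $ 8 * ?q3) = 0" "c1 * (z $ 7 * ?q3) = 0" "c1 * (z $ 3 * ?q2) = 0"
    "(c1 ^ 3 + c2 ^ 3) * (z $ 3 * z $ 5 * z $ 7) = 0" "(c1 ^ 3 + c2 ^ 3) * (z $ 1 * z $ 6 * z $ 8) = 0" "c1 * (z $ 6 * ?q1) = 0"
    "c1 * (z $ 1 * ?q2) = 0" "c1 * (z $ 5 * ?q1) = 0" "c2 * (z $ 1 * ?q1) = 0"
    "c2 * (z $ 8 * ?q2) = 0" "c2 * (z $ 5 * ?q2) = 0"
    using E[unfolded pf6 skew_matrix_entries z] by algebra+
  then have F: "z $ 6 * ?q3 = 0" "z $ 7 * ?q1 = 0" "z $ 3 * ?q3 = 0" "z $ 8 * ?q3 = 0"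
    "z $ 7 * ?q3 = 0" "z $ 3 * ?q2 = 0" "z $ 3 * z $ 5 * z $ 7 = 0" "z $ 1 * z $ 6 * z $ 8 = 0"
    "z $ 6 * ?q1 = 0" "z $ 1 * ?q2 = 0" "z $ 5 * ?q1 = 0" "z $ 1 * ?q1 = 0"
    "z $ 8 * ?q2 = 0" "z $ 5 * ?q2 = 0"
    using c by auto
  then have "z $ 8 = 0 \<and> z $ 3 = 0 \<or> z $ 7 = 0 \<and> z $ 6 = 0 \<or> z $ 5 = 0 \<and> z $ 1 = 0"
    using c by (cases "z $ 3 = 0"; cases "z $ 1 = 0"; cases "z $ 5 = 0"; auto)
  moreover have "?q1 = 0" if "z $ 8 = 0 \<and> z $ 3 = 0"
    using F that by (cases "z $ 1 = 0"; cases "z $ 5 = 0"; simp)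
  moreover have "?q2 = 0" if "z $ 7 = 0 \<and> z $ 6 = 0"
    using F that by (cases "z $ 1 = 0"; cases "z $ 5 = 0"; simp)
  moreover have "?q3 = 0" if "z $ 5 = 0 \<and> z $ 1 = 0"
    using F that by (cases "z $ 3 = 0"; cases "z $ 8 = 0"; simp)
  ultimately show ?Q
    by blast
qed

lemma coeff_nonzero:
  fixes c1 c2 :: "'k::field"
  assumes "c1 * c2 * (c1 ^ 6 - c2 ^ 6) \<noteq> 0"
  shows "c1 \<noteq> 0" "c2 \<noteq> 0" "c1 ^ 3 + c2 ^ 3 \<noteq> 0" "c1 ^ 3 - c2 ^ 3 \<noteq> 0"
proof -
  have "c1 ^ 6 - c2 ^ 6 = (c1 ^ 3 + c2 ^ 3) * (c1 ^ 3 - c2 ^ 3)"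
    by algebra
  then show "c1 \<noteq> 0" "c2 \<noteq> 0" "c1 ^ 3 + c2 ^ 3 \<noteq> 0" "c1 ^ 3 - c2 ^ 3 \<noteq> 0"
    using assms by auto
qed

lemma quadric_scale:
  "a * (t * w) * (t * x) - b * (t * y) * (t * z) = t\<^sup>2 * (a * w * x - b * y * z :: 'k::field)"
  by (simp add: power2_eq_square algebra_simps)

lemma ball_point_disj:
  fixes p :: "('k::field ^ 'n) set"
  assumes "p \<in> proj_space"
    and "\<And>t v. t \<noteq> 0 \<Longrightarrow> P v \<Longrightarrow> P (t *s v)"
    and "\<And>t v. t \<noteq> 0 \<Longrightarrow> Q v \<Longrightarrow> Q (t *s v)"
    and "\<And>t v. t \<noteq> 0 \<Longrightarrow> R v \<Longrightarrow> R (t *s v)"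
  shows "(\<forall>v\<in>p. P v \<or> Q v \<or> R v) \<longleftrightarrow> (\<forall>v\<in>p. P v) \<or> (\<forall>v\<in>p. Q v) \<or> (\<forall>v\<in>p. R v)"
proof -
  obtain v where p: "p = {t *s v | t. t \<noteq> 0}"
    using assms(1) unfolding proj_space_def hpoint_def by blast
  have "v = 1 *s v" "(1 :: 'k) \<noteq> 0"
    by simp_all
  then have "v \<in> p"
    unfolding p by blast
  then show ?thesis
    using assms(2-4) unfolding p by blast
qed

lemma X1_eq:
  fixes c1 c2 :: "'k::field"
  assumes "c1 * c2 * (c1 ^ 6 - c2 ^ 6) \<noteq> 0"
  shows "X1 c1 c2 =
    {p \<in> proj_space. \<forall>z\<in>p. z $ 8 = 0 \<and> z $ 7 = 0 \<and> z $ 6 = 0 \<and> z $ 2 = 0 \<and> z $ 1 = 0 \<and>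
       c2\<^sup>2 * z $ 4 * z $ 5 - c1\<^sup>2 * z $ 3 * z $ 9 = 0} \<union>
    {p \<in> proj_space. \<forall>z\<in>p. z $ 9 = 0 \<and> z $ 8 = 0 \<and> z $ 6 = 0 \<and> z $ 5 = 0 \<and> z $ 1 = 0 \<and>
       c2\<^sup>2 * z $ 2 * z $ 3 - c1\<^sup>2 * z $ 4 * z $ 7 = 0} \<union>
    {p \<in> proj_space. \<forall>z\<in>p. z $ 8 = 0 \<and> z $ 6 = 0 \<and> z $ 4 = 0 \<and> z $ 3 = 0 \<and> z $ 1 = 0 \<and>
       c2\<^sup>2 * z $ 7 * z $ 9 - c1\<^sup>2 * z $ 2 * z $ 5 = 0}"
    (is "_ = {p \<in> _. \<forall>z\<in>p. ?P z} \<union> {p \<in> _. \<forall>z\<in>p. ?Q z} \<union> {p \<in> _. \<forall>z\<in>p. ?R z}")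
proof -
  note c = coeff_nonzero[OF assms]
  have "X1 c1 c2 = {p \<in> proj_space. \<forall>z\<in>p. ?P z \<or> ?Q z \<or> ?R z}"
    using pfaffians_vanish_X1[OF c(1-3)] unfolding X1_def pfaffian_locus_def by fast
  also have "\<dots> = {p \<in> proj_space. (\<forall>z\<in>p. ?P z) \<or> (\<forall>z\<in>p. ?Q z) \<or> (\<forall>z\<in>p. ?R z)}"
    by (intro Collect_cong conj_cong refl ball_point_disj) (auto simp: quadric_scale)
  finally show ?thesis
    by blast
qed

lemma X2_eq:
  fixes c1 c2 :: "'k::field"
  assumes "c1 * c2 * (c1 ^ 6 - c2 ^ 6) \<noteq> 0"
  shows "X2 c1 c2 =
    {p \<in> proj_space. \<forall>z\<in>p. z $ 7 = 0 \<and> z $ 9 = 0 \<and> z $ 5 = 0 \<and> z $ 1 = 0 \<and> z $ 3 = 0 \<and>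
       c2\<^sup>2 * z $ 6 * z $ 4 - c1\<^sup>2 * z $ 2 * z $ 8 = 0} \<union>
    {p \<in> proj_space. \<forall>z\<in>p. z $ 8 = 0 \<and> z $ 7 = 0 \<and> z $ 5 = 0 \<and> z $ 4 = 0 \<and> z $ 3 = 0 \<and>
       c2\<^sup>2 * z $ 1 * z $ 2 - c1\<^sup>2 * z $ 6 * z $ 9 = 0} \<union>
    {p \<in> proj_space. \<forall>z\<in>p. z $ 7 = 0 \<and> z $ 5 = 0 \<and> z $ 6 = 0 \<and> z $ 2 = 0 \<and> z $ 3 = 0 \<and>
       c2\<^sup>2 * z $ 9 * z $ 8 - c1\<^sup>2 * z $ 1 * z $ 4 = 0}"
    (is "_ = {p \<in> _. \<forall>z\<in>p. ?P z} \<union> {p \<in> _. \<forall>z\<in>p. ?Q z} \<union> {p \<in> _. \<forall>z\<in>p. ?R z}")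
proof -
  note c = coeff_nonzero[OF assms]
  have "X2 c1 c2 = {p \<in> proj_space. \<forall>z\<in>p. ?P z \<or> ?Q z \<or> ?R z}"
    using pfaffians_vanish_X2[OF c(1-3)] unfolding X2_def pfaffian_locus_def by fast
  also have "\<dots> = {p \<in> proj_space. (\<forall>z\<in>p. ?P z) \<or> (\<forall>z\<in>p. ?Q z) \<or> (\<forall>z\<in>p. ?R z)}"
    by (intro Collect_cong conj_cong refl ball_point_disj) (auto simp: quadric_scale)
  finally show ?thesis
    by blast
qed

lemma X3_eq:
  fixes c1 c2 :: "'k::field"
  assumes "c1 * c2 * (c1 ^ 6 - c2 ^ 6) \<noteq> 0"
  shows "X3 c1 c2 =
    {p \<in> proj_space. \<forall>z\<in>p. z $ 9 = 0 \<and> z $ 8 = 0 \<and> z $ 4 = 0 \<and> z $ 3 = 0 \<and> z $ 2 = 0 \<and>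
       c2\<^sup>2 * z $ 5 * z $ 6 - c1\<^sup>2 * z $ 1 * z $ 7 = 0} \<union>
    {p \<in> proj_space. \<forall>z\<in>p. z $ 7 = 0 \<and> z $ 9 = 0 \<and> z $ 4 = 0 \<and> z $ 6 = 0 \<and> z $ 2 = 0 \<and>
       c2\<^sup>2 * z $ 3 * z $ 1 - c1\<^sup>2 * z $ 5 * z $ 8 = 0} \<union>
    {p \<in> proj_space. \<forall>z\<in>p. z $ 9 = 0 \<and> z $ 4 = 0 \<and> z $ 5 = 0 \<and> z $ 1 = 0 \<and> z $ 2 = 0 \<and>
       c2\<^sup>2 * z $ 8 * z $ 7 - c1\<^sup>2 * z $ 3 * z $ 6 = 0}"
    (is "_ = {p \<in> _. \<forall>z\<in>p. ?P z} \<union> {p \<in> _. \<forall>z\<in>p. ?Q z} \<union> {p \<in> _. \<forall>z\<in>p. ?R z}")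
proof -
  note c = coeff_nonzero[OF assms]
  have "X3 c1 c2 = {p \<in> proj_space. \<forall>z\<in>p. ?P z \<or> ?Q z \<or> ?R z}"
    using pfaffians_vanish_X3[OF c(1-3)] unfolding X3_def pfaffian_locus_def by fast
  also have "\<dots> = {p \<in> proj_space. (\<forall>z\<in>p. ?P z) \<or> (\<forall>z\<in>p. ?Q z) \<or> (\<forall>z\<in>p. ?R z)}"
    by (intro Collect_cong conj_cong refl ball_point_disj) (auto simp: quadric_scale)
  finally show ?thesis
    by blast
qed

lemma pfaffian_locus_eq:
  fixes c1 c2 :: "'k::field"
  assumes "c1 * c2 * (c1 ^ 6 - c2 ^ 6) \<noteq> 0"
  shows "pfaffian_locus c1 c2 = X1 c1 c2 \<union> X2 c1 c2 \<union> X3 c1 c2"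
    (is "?L = _")
proof -
  let ?P = "\<lambda>z :: 'k ^ 9. z $ 1 = 0 \<and> z $ 6 = 0 \<and> z $ 8 = 0"
  let ?Q = "\<lambda>z :: 'k ^ 9. z $ 3 = 0 \<and> z $ 5 = 0 \<and> z $ 7 = 0"
  let ?R = "\<lambda>z :: 'k ^ 9. z $ 2 = 0 \<and> z $ 4 = 0 \<and> z $ 9 = 0"
  note c = coeff_nonzero[OF assms]
  have "(\<forall>z\<in>p. ?P z) \<or> (\<forall>z\<in>p. ?Q z) \<or> (\<forall>z\<in>p. ?R z)" if "p \<in> ?L" for p
  proof -
    have "p \<in> proj_space" "\<forall>z\<in>p. ?P z \<or> ?Q z \<or> ?R z"
      using that pfaffians_vanish_cases[OF c] unfolding pfaffian_locus_def by fast+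
    then show ?thesis
      by (subst (asm) ball_point_disj) auto
  qed
  then show ?thesis
    unfolding X1_def X2_def X3_def by blast
qed

end

theory Submission
  imports Defs
begin

text \<open>
  Number the six coordinates that survive on a piece as \<open>z\<^sub>a\<^sub>b\<close> with \<open>a \<in> \<int>/3\<close>, \<open>b \<in> {1, 2}\<close>. Then its three
  quadrics are \<open>z\<^sub>a\<^sub>1 z\<^sub>a\<^sub>+\<^sub>1\<^sub>,\<^sub>2 = \<lambda> z\<^sub>a\<^sub>2 z\<^sub>a\<^sub>+\<^sub>1\<^sub>,\<^sub>1\<close>, \<open>z\<^sub>a\<^sub>+\<^sub>2\<^sub>,\<^sub>1 = z\<^sub>a\<^sub>+\<^sub>2\<^sub>,\<^sub>2 = 0\<close>, with \<open>\<lambda> = c\<^sub>1\<^sup>2/c\<^sub>2\<^sup>2\<close>: a Segre quadric over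
  each edge of the triangle, two of them meeting in the line over a vertex. Over the two edges
  through vertex \<open>k\<close> both twists are removed by rescaling \<open>z\<^sub>a\<^sub>2\<close> by \<open>\<lambda>\<^sup>a\<^sup>-\<^sup>k\<close> (\<open>a - k \<in> {-1, 0, 1}\<close>), so
  that \<open>z\<^sub>a\<^sub>b = x\<^sub>a w\<^sub>b\<close> up to these constants identifies the part over \<open>x\<^sub>k \<noteq> 0\<close> with a product. The
  transition matrices are the constants \<open>diag(1, \<lambda>\<^sup>j\<^sup>-\<^sup>k)\<close>; the cocycle condition holds although
  \<open>\<lambda>\<^sup>3 \<noteq> 1\<close> because the three charts have no common point.
\<close>

section \<open>Points, forms and regular maps\<close>

lemma mem_hpoint: "w \<in> hpoint v \<longleftrightarrow> (\<exists>t. t \<noteq> 0 \<and> w = t *s v)"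
  by (auto simp: hpoint_def)

lemma self_mem_hpoint: "v \<in> hpoint v"
  unfolding mem_hpoint by (rule exI[of _ 1]) simp

lemma hpoint_scale:
  assumes "t \<noteq> 0"
  shows "hpoint (t *s v) = hpoint v"
proof
  show "hpoint (t *s v) \<subseteq> hpoint v"
  proof
    fix u assume "u \<in> hpoint (t *s v)"
    then obtain r where "r \<noteq> 0" "u = r *s (t *s v)"
      unfolding mem_hpoint by blast
    then show "u \<in> hpoint v"
      using assms unfolding mem_hpoint by (intro exI[of _ "r * t"]) simp
  qed
  show "hpoint v \<subseteq> hpoint (t *s v)"
  proof
    fix u assume "u \<in> hpoint v"
    then obtain r where "r \<noteq> 0" "u = r *s v"
      unfolding mem_hpoint by blast
    then show "u \<in> hpoint (t *s v)"
      using assms unfolding mem_hpoint by (intro exI[of _ "r / t"]) simp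
  qed
qed

lemma hpoint_eqI: "w \<in> hpoint v \<Longrightarrow> hpoint w = hpoint v"
  by (auto simp: mem_hpoint hpoint_scale)

lemma hpoint_in_proj_space: "hpoint v \<in> proj_space \<longleftrightarrow> v \<noteq> 0"
proof
  assume "hpoint v \<in> proj_space"
  then obtain u where u: "u \<noteq> 0" "hpoint v = hpoint u"
    by (auto simp: proj_space_def)
  then have "u \<in> hpoint v"
    using self_mem_hpoint[of u] by simp
  then show "v \<noteq> 0"
    using u(1) by (auto simp: mem_hpoint)
qed (auto simp: proj_space_def)

lemma proj_spaceE:
  assumes "p \<in> proj_space"
  obtains v where "v \<noteq> 0" "p = hpoint v"
  using assms by (auto simp: proj_space_def)

lemma proj_space_eq_hpoint:
  assumes "p \<in> proj_space" "v \<in> p"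
  shows "p = hpoint v"
  using assms hpoint_eqI by (auto simp: proj_space_def)

text \<open>Conditions on points quantify over all representatives; scale invariance lets them be
  tested on one.\<close>

lemma ball_hpoint:
  assumes "\<And>t v. t \<noteq> 0 \<Longrightarrow> P v \<Longrightarrow> P (t *s v)"
  shows "(\<forall>z\<in>hpoint v. P z) \<longleftrightarrow> P v"
proof
  show "P v" if "\<forall>z\<in>hpoint v. P z"
    using that self_mem_hpoint by blast
qed (use assms in \<open>auto simp: mem_hpoint\<close>)

lemma image_hpoint:
  assumes "\<And>t v. L (t *s v) = t *s L v"
  shows "L ` hpoint v = hpoint (L v)"
proof -
  have "L ` hpoint v = {L (t *s v) | t. t \<noteq> 0}"
    unfolding hpoint_def by blast
  then show ?thesis
    by (simp add: assms hpoint_def)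
qed

section \<open>Forms, the Zariski topology and regular maps\<close>

lemma form_const: "form 0 (\<lambda>_. c)"
  unfolding form_def by (rule exI[of _ "{\<lambda>_. 0}"]) (auto intro!: exI[of _ "\<lambda>_. c"])

lemma form_linear_monomial: "form 1 (\<lambda>v. c * v $ i)"
proof -
  let ?m = "\<lambda>j. if j = i then 1 else 0 :: nat"
  have "(\<Prod>j\<in>UNIV. v $ j ^ ?m j) = v $ i" for v :: "'a ^ 'b"
  proof -
    have "(\<Prod>j\<in>UNIV. v $ j ^ ?m j) = (\<Prod>j\<in>UNIV. if j = i then v $ j else 1)"
      by (rule prod.cong) auto
    then show ?thesis
      by simp
  qed
  then show ?thesis
    unfolding form_def by (intro exI[of _ "{?m}"] exI[of _ "\<lambda>_. c"]) auto
qed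

lemma openin_form_nonzero:
  assumes "form d F"
  shows "openin zariski {p \<in> proj_space. \<forall>v\<in>p. F v \<noteq> 0}"
  unfolding zariski_def
  by (rule topology_generated_by_Basis, rule CollectI, intro exI conjI) (rule refl, rule assms)

lemma zariski_subset_proj_space: "openin zariski U \<Longrightarrow> U \<subseteq> proj_space"
  unfolding zariski_def using openin_subset topology_generated_by_topspace by fastforce

text \<open>The constant form 1 vanishes nowhere, so the whole projective space is among the
  generating open sets.\<close>

lemma topspace_zariski: "topspace zariski = (proj_space :: ('k::field ^ 'n) set set)"
proof
  show "topspace zariski \<subseteq> (proj_space :: ('k ^ 'n) set set)"
    by (rule zariski_subset_proj_space) simp
  have "openin zariski {p \<in> proj_space :: ('k ^ 'n) set set. \<forall>v\<in>p. (1 :: 'k) \<noteq> 0}"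
    by (rule openin_form_nonzero[OF form_const])
  then have "openin zariski (proj_space :: ('k ^ 'n) set set)"
    by simp
  then show "(proj_space :: ('k ^ 'n) set set) \<subseteq> topspace zariski"
    by (rule openin_subset)
qed

lemma openin_whole:
  assumes "X \<subseteq> proj_space"
  shows "openin (subtopology zariski X) X"
  using assms by (simp add: openin_subtopology_refl topspace_zariski)

lemma openin_coordinate_nonzero:
  assumes "X \<subseteq> proj_space"
  shows "openin (subtopology zariski X) {p \<in> X. \<forall>v\<in>p. v $ i \<noteq> 0}"
proof -
  have "form 1 (\<lambda>v. v $ i)"
    using form_linear_monomial[of 1 i] by simp
  then have "openin zariski {p \<in> proj_space. \<forall>v\<in>p. v $ i \<noteq> 0}"
    by (rule openin_form_nonzero)
  moreover have "{p \<in> X. \<forall>v\<in>p. v $ i \<noteq> 0} = {p \<in> proj_space. \<forall>v\<in>p. v $ i \<noteq> 0} \<inter> X"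
    using assms by auto
  ultimately show ?thesis
    unfolding openin_subtopology by blast
qed

lemma regular_function_const:
  assumes "X \<subseteq> proj_space"
  shows "regular_function X (\<lambda>_. c)"
  unfolding regular_function_def
proof
  fix p assume "p \<in> X"
  then show "\<exists>V d F G. openin (subtopology zariski X) V \<and> p \<in> V \<and> form d F \<and> form d G \<and>
      (\<forall>q\<in>V. \<forall>v\<in>q. G v \<noteq> 0 \<and> c = F v / G v)"
    using openin_whole[OF assms] form_const[of c] form_const[of 1]
    by (intro exI[of _ X] exI[of _ 0] exI[of _ "\<lambda>_. c"] exI[of _ "\<lambda>_. 1"]) auto
qed

text \<open>A point is determined by any of its representatives, so the double quantification over
  \<open>q\<close> and \<open>v\<close> in \<open>regular_map\<close> collapses to one over vectors
  \<open>u\<close>.\<close>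

lemma regular_mapI:
  assumes "X \<subseteq> proj_space" "\<And>p. p \<in> X \<Longrightarrow> f p \<in> Y"
    and loc: "\<And>p. p \<in> X \<Longrightarrow> \<exists>V d F. openin (subtopology zariski X) V \<and> p \<in> V \<and>
      (\<forall>i. form d (F i)) \<and>
      (\<forall>u. hpoint u \<in> V \<longrightarrow> (\<chi> i. F i u) \<noteq> 0 \<and> f (hpoint u) = hpoint (\<chi> i. F i u))"
  shows "regular_map X Y f"
  unfolding regular_map_def
proof (intro conjI ballI)
  show "f \<in> X \<rightarrow> Y"
    using assms(2) by blast
  fix p assume "p \<in> X"
  then obtain V d F where V: "openin (subtopology zariski X) V" "p \<in> V" "\<forall>i. form d (F i)"
    and F: "\<forall>u. hpoint u \<in> V \<longrightarrow> (\<chi> i. F i u) \<noteq> 0 \<and> f (hpoint u) = hpoint (\<chi> i. F i u)"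
    using loc[OF \<open>p \<in> X\<close>] by (elim exE conjE)
  have "(\<chi> i. F i v) \<noteq> 0 \<and> f q = hpoint (\<chi> i. F i v)" if "q \<in> V" "v \<in> q" for q v
  proof -
    have "q \<in> proj_space"
      using V(1) that(1) assms(1) openin_imp_subset by blast
    then have q: "q = hpoint v"
      using that(2) by (rule proj_space_eq_hpoint)
    show ?thesis
      using F that(1) unfolding q by simp
  qed
  then have "\<forall>q\<in>V. \<forall>v\<in>q. (\<chi> i. F i v) \<noteq> 0 \<and> f q = hpoint (\<chi> i. F i v)"
    by simp
  with V show "\<exists>V d F. openin (subtopology zariski X) V \<and> p \<in> V \<and> (\<forall>i. form d (F i)) \<and>
      (\<forall>q\<in>V. \<forall>v\<in>q. (\<chi> i. F i v) \<noteq> 0 \<and> f q = hpoint (\<chi> i. F i v))"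
    by (intro exI conjI)
qed

lemma regular_map_image:
  assumes "X \<subseteq> proj_space" "\<And>p. p \<in> X \<Longrightarrow> L ` p \<in> Y"
    and hom: "\<And>t v. L (t *s v) = t *s L v"
    and "\<And>i. form d (\<lambda>v. L v $ i)"
    and "\<And>v. hpoint v \<in> X \<Longrightarrow> L v \<noteq> 0"
  shows "regular_map X Y ((`) L)"
proof (rule regular_mapI)
  fix p assume "p \<in> X"
  then show "\<exists>V d F. openin (subtopology zariski X) V \<and> p \<in> V \<and> (\<forall>i. form d (F i)) \<and>
      (\<forall>u. hpoint u \<in> V \<longrightarrow> (\<chi> i. F i u) \<noteq> 0 \<and> L ` hpoint u = hpoint (\<chi> i. F i u))"
    using assms openin_whole[OF assms(1)] image_hpoint[of L, OF hom]
    by (intro exI[of _ X] exI[of _ d] exI[of _ "\<lambda>i v. L v $ i"]) auto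
qed (use assms in auto)

section \<open>Segre products in coordinates, as rank one matrices\<close>

definition outer :: "'k::field ^ 'm \<Rightarrow> 'k ^ 'n \<Rightarrow> 'k ^ ('m \<times> 'n)" where
  "outer v w = (\<chi> ij. v $ fst ij * w $ snd ij)"

lemma outer_nth: "outer v w $ (i, j) = v $ i * w $ j"
  by (simp add: outer_def)

lemma outer_scale: "outer (s *s v) (t *s w) = (s * t) *s outer v w"
  by (simp add: outer_def vec_eq_iff mult_ac)

lemma outer_eq_0_iff: "outer v w = 0 \<longleftrightarrow> v = 0 \<or> w = 0"
  by (auto simp: vec_eq_iff outer_def)

text \<open>The scalars on the two factors enter only through their product, so one of them can
  absorb both.\<close>

lemma segre_hpoint: "segre (hpoint v) (hpoint w) = hpoint (outer v w)"
proof
  show "segre (hpoint v) (hpoint w) \<subseteq> hpoint (outer v w)"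
  proof
    fix y assume "y \<in> segre (hpoint v) (hpoint w)"
    then obtain s t where "s \<noteq> 0" "t \<noteq> 0" "y = outer (s *s v) (t *s w)"
      unfolding segre_def outer_def mem_hpoint by blast
    then show "y \<in> hpoint (outer v w)"
      unfolding mem_hpoint outer_scale by (intro exI[of _ "s * t"]) simp
  qed
  show "hpoint (outer v w) \<subseteq> segre (hpoint v) (hpoint w)"
  proof
    fix y assume "y \<in> hpoint (outer v w)"
    then obtain t where t: "t \<noteq> 0" "y = t *s outer v w"
      unfolding mem_hpoint by blast
    then have "y = outer (t *s v) w"
      using outer_scale[of t v 1 w] by simp
    moreover have "t *s v \<in> hpoint v"
      using t(1) unfolding mem_hpoint by blast
    ultimately show "y \<in> segre (hpoint v) (hpoint w)"
      unfolding segre_def outer_def using self_mem_hpoint[of w] by blast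
  qed
qed

lemma hpoint_in_triangle_cubic:
  "hpoint v \<in> triangle_cubic \<longleftrightarrow> v \<noteq> 0 \<and> v $ 1 * v $ 2 * v $ 3 = 0"
proof -
  have "(\<forall>u\<in>hpoint v. u $ 1 * u $ 2 * u $ 3 = 0) \<longleftrightarrow> v $ 1 * v $ 2 * v $ 3 = 0"
    by (rule ball_hpoint) auto
  then show ?thesis
    by (simp add: triangle_cubic_def hpoint_in_proj_space)
qed


section \<open>A cycle of three quadrics\<close>

text \<open>The index type is the ring of integers modulo 3, so \<open>a + 1\<close> and
  \<open>a + 2\<close> run around the triangle and the vertex 3 is 0.\<close>

lemma mod_3: "(4 :: 3) = 1" "(5 :: 3) = 2"
  by simp_all

locale quadric_triangle =
  fixes e :: "3 \<times> 2 \<Rightarrow> 'n::finite" and lam :: "'k::field"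
  assumes inj_e: "inj e" and lam_nonzero: "lam \<noteq> 0"
begin

definition on_surface :: "'k ^ 'n \<Rightarrow> bool" where
  "on_surface z \<longleftrightarrow> (\<forall>i. i \<notin> range e \<longrightarrow> z $ i = 0) \<and>
     (\<exists>a. z $ e (a + 2, 1) = 0 \<and> z $ e (a + 2, 2) = 0 \<and>
        z $ e (a, 1) * z $ e (a + 1, 2) = lam * z $ e (a, 2) * z $ e (a + 1, 1))"

definition surface :: "('k ^ 'n) set set" where
  "surface = {p \<in> proj_space. \<forall>z\<in>p. on_surface z}"

text \<open>\<open>twist (a - b) = lam\<^sup>m\<close> where \<open>m \<in> {-1, 0, 1}\<close> is the number of steps from \<open>b\<close> to \<open>a\<close> around the
  triangle. It is not multiplicative, and the failure \<open>lam ^ 3\<close> is the monodromy of the bundle.\<close>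

definition twist :: "3 \<Rightarrow> 'k" where
  "twist d = (if d = 0 then 1 else if d = 1 then lam else inverse lam)"

definition weight :: "3 \<Rightarrow> 3 \<times> 2 \<Rightarrow> 'k" where
  "weight k ab = (if snd ab = 1 then 1 else twist (fst ab - k))"

definition chart :: "3 \<Rightarrow> 'k ^ (3 \<times> 2) \<Rightarrow> 'k ^ 'n" where
  "chart k y = (\<chi> i. if i \<in> range e then weight k (inv e i) * y $ inv e i else 0)"

definition chart_inv :: "3 \<Rightarrow> 'k ^ 'n \<Rightarrow> 'k ^ (3 \<times> 2)" where
  "chart_inv k z = (\<chi> ab. inverse (weight k ab) * z $ e ab)"

definition transition :: "3 \<Rightarrow> 3 \<Rightarrow> 'k ^ 2 ^ 2" where
  "transition j k = (\<chi> a b. if a \<noteq> b then 0 else if a = 1 then 1 else twist (j - k))"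

text \<open>The two edges through vertex \<open>k\<close>, without their other end points.\<close>

definition corner :: "3 \<Rightarrow> ('k ^ 3) set set" where
  "corner k = {p \<in> triangle_cubic. \<forall>v\<in>p. v $ k \<noteq> 0}"

text \<open>A choice operator avoids fixing a chart for each point; \<open>base_point_chart\<close>
  shows that the chosen value does not depend on the chart.\<close>

definition base_point :: "('k ^ 'n) set \<Rightarrow> ('k ^ 3) set" where
  "base_point x = (SOME p. \<exists>k v w. hpoint v \<in> corner k \<and> w \<noteq> 0 \<and>
     p = hpoint v \<and> x = hpoint (chart k (outer v w)))"

section \<open>Twists, charts and corners\<close>

lemma twist_nonzero: "twist d \<noteq> 0"
  using lam_nonzero by (simp add: twist_def)

text \<open>Since some coordinate of \<open>v\<close> vanishes, \<open>i\<close>, \<open>j\<close>,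
  \<open>k\<close> cannot be pairwise distinct; with a coincidence the identity reduces to
  \<open>twist 0 = 1\<close> and \<open>twist d * twist (- d) = 1\<close>. For distinct indices it
  would need \<open>lam ^ 3 = 1\<close>.\<close>

lemma twist_cocycle:
  assumes "v $ 1 * v $ 2 * v $ 3 = (0 :: 'k)" "v $ i \<noteq> 0" "v $ j \<noteq> 0" "v $ k \<noteq> 0"
  shows "twist (i - j) * twist (j - k) = twist (i - k)"
  using assms lam_nonzero exhaust_3[of i] exhaust_3[of j] exhaust_3[of k]
  by (auto simp: twist_def)

lemma weight_nonzero: "weight k ab \<noteq> 0"
  by (simp add: weight_def twist_nonzero)

lemma chart_nth: "chart k y $ e ab = weight k ab * y $ ab"
  using inj_e by (simp add: chart_def)

lemma chart_outside: "i \<notin> range e \<Longrightarrow> chart k y $ i = 0"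
  by (simp add: chart_def)

lemma chart_scale: "chart k (t *s y) = t *s chart k y"
  by (simp add: chart_def vec_eq_iff)

lemma chart_inv_scale: "chart_inv k (t *s y) = t *s chart_inv k y"
  by (simp add: chart_inv_def vec_eq_iff)

lemma chart_inv_chart: "chart_inv k (chart k y) = y"
  by (simp add: chart_inv_def chart_nth vec_eq_iff weight_nonzero)

lemma chart_chart_inv:
  assumes "\<And>i. i \<notin> range e \<Longrightarrow> z $ i = 0"
  shows "chart k (chart_inv k z) = z"
proof -
  have "chart k (chart_inv k z) $ i = z $ i" for i
  proof (cases "i \<in> range e")
    case True
    then show ?thesis
      by (auto simp: chart_nth chart_inv_def weight_nonzero)
  qed (simp add: chart_outside assms)
  then show ?thesis
    by (simp add: vec_eq_iff)
qed

lemma chart_eq_0_iff: "chart k y = 0 \<longleftrightarrow> y = 0"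
proof -
  have "chart k 0 = 0"
    by (simp add: chart_def vec_eq_iff)
  then show ?thesis
    using chart_inv_chart by metis
qed

lemma hpoint_in_corner:
  "hpoint v \<in> corner k \<longleftrightarrow> v $ 1 * v $ 2 * v $ 3 = 0 \<and> v $ k \<noteq> 0"
proof -
  have "(\<forall>u\<in>hpoint v. u $ k \<noteq> 0) \<longleftrightarrow> v $ k \<noteq> 0"
    by (rule ball_hpoint) simp
  then show ?thesis
    by (auto simp: corner_def hpoint_in_triangle_cubic)
qed

lemma corner_subset: "corner k \<subseteq> triangle_cubic" "corner k \<subseteq> proj_space"
  by (auto simp: corner_def triangle_cubic_def)

lemma Union_corner: "corner 1 \<union> (corner 2 \<union> corner 3) = triangle_cubic"
proof
  show "triangle_cubic \<subseteq> corner 1 \<union> (corner 2 \<union> corner 3)"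
  proof
    fix p :: "('k ^ 3) set" assume p: "p \<in> triangle_cubic"
    then obtain v where "p = hpoint v"
      unfolding triangle_cubic_def by (auto elim: proj_spaceE)
    then show "p \<in> corner 1 \<union> (corner 2 \<union> corner 3)"
      using p by (simp add: hpoint_in_corner hpoint_in_triangle_cubic vec_eq_iff forall_3)
  qed
qed (use corner_subset in simp)

lemma cornerE:
  assumes "p \<in> corner k"
  obtains v where "p = hpoint v" "v $ 1 * v $ 2 * v $ 3 = 0" "v $ k \<noteq> 0"
  using assms corner_subset(2) hpoint_in_corner by (metis in_mono proj_spaceE)

section \<open>The surface seen through the charts\<close>

lemma on_surface_scale:
  assumes "on_surface z"
  shows "on_surface (t *s z)"
proof -
  obtain a where "\<forall>i. i \<notin> range e \<longrightarrow> z $ i = 0" "z $ e (a + 2, 1) = 0" "z $ e (a + 2, 2) = 0"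
    "z $ e (a, 1) * z $ e (a + 1, 2) = lam * z $ e (a, 2) * z $ e (a + 1, 1)"
    using assms unfolding on_surface_def by blast
  then show ?thesis
    unfolding on_surface_def by (intro conjI exI[of _ a]) (simp_all add: mult_ac)
qed

lemma hpoint_in_surface: "hpoint z \<in> surface \<longleftrightarrow> z \<noteq> 0 \<and> on_surface z"
proof -
  have "(\<forall>u\<in>hpoint z. on_surface u) \<longleftrightarrow> on_surface z"
    by (rule ball_hpoint) (rule on_surface_scale)
  then show ?thesis
    by (simp add: surface_def hpoint_in_proj_space)
qed

text \<open>The base point lies on the edge from \<open>k\<close> to \<open>k + 1\<close> or on the
  edge from \<open>k + 2\<close> to \<open>k\<close>. The relative weight of the two ends is
  \<open>lam\<close> on either edge, just the factor in the quadric.\<close>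

lemma on_surface_chart:
  assumes v: "v $ 1 * v $ 2 * v $ 3 = 0" "v $ k \<noteq> 0"
  shows "on_surface (chart k (outer v w))"
proof -
  have "v $ (k + 2) = 0 \<or> v $ (k + 1) = 0"
    using v exhaust_3[of k] by (auto simp: mod_3)
  then show ?thesis
  proof
    assume "v $ (k + 2) = 0"
    then show ?thesis
      unfolding on_surface_def
      by (auto intro!: exI[of _ k] simp: chart_outside chart_nth outer_nth weight_def twist_def)
  next
    assume v1: "v $ (k + 1) = 0"
    \<comment> \<open>The edge used below starts at \<open>k + 2\<close>; the vertex opposite to it
      is \<open>k + 2 + 2\<close>, which is \<open>k + 1\<close> modulo 3.\<close>
    have four: "4 + k = k + 1"
      by (simp add: mod_3)
    have "v $ (4 + k) = 0"
      by (simp only: four v1)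
    moreover have "k + 2 + 1 = k"
      by (simp add: add.assoc)
    ultimately show ?thesis
      unfolding on_surface_def using lam_nonzero
      by (auto intro!: exI[of _ "k + 2"]
          simp: chart_outside chart_nth outer_nth weight_def twist_def)
  qed
qed

text \<open>Untwisting turns the quadric into the vanishing of a 2 by 2 minor, so the 3 by 2 matrix
  \<open>y\<close> has rank one and factors through its column \<open>b\<close> and its row
  \<open>k\<close>.\<close>

lemma chart_surj:
  assumes z: "on_surface z" and nz: "z $ e (k, b) \<noteq> 0"
  obtains v w where "z = chart k (outer v w)" "v $ 1 * v $ 2 * v $ 3 = 0" "v $ k \<noteq> 0" "w $ b \<noteq> 0"
proof -
  define y where "y = chart_inv k z"
  have z_eq: "z = chart k y"
    unfolding y_def using z chart_chart_inv on_surface_def by metis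
  have y: "y $ (k, b) \<noteq> 0"
    using nz by (simp add: z_eq chart_nth)
  obtain a where a: "y $ (a + 2, 1) = 0" "y $ (a + 2, 2) = 0"
    and eq: "weight k (a, 1) * y $ (a, 1) * (weight k (a + 1, 2) * y $ (a + 1, 2)) =
      lam * (weight k (a, 2) * y $ (a, 2)) * (weight k (a + 1, 1) * y $ (a + 1, 1))"
    using z unfolding on_surface_def z_eq chart_nth by (auto simp: weight_nonzero)
  have zero: "y $ (a + 2, c) = 0" for c
    using a exhaust_2[of c] by auto
  then have "k \<noteq> a + 2"
    using y by auto
  \<comment> \<open>The row \<open>a + 2\<close> vanishes, so \<open>k\<close> is an end of the
    edge; only there do the weights of chart \<open>k\<close> cancel \<open>lam\<close>.\<close>
  then have k: "k = a \<or> k = a + 1"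
    using exhaust_3[of k] exhaust_3[of a] by auto
  have rank1: "y $ (a, 1) * y $ (a + 1, 2) = y $ (a, 2) * y $ (a + 1, 1)"
    using k eq lam_nonzero by (auto simp: weight_def twist_def)
  \<comment> \<open>Only minors through the nonzero pivot \<open>(k, b)\<close> are needed to factor
    \<open>y\<close>.\<close>
  have minors: "y $ (c, b) * y $ (k, d) = y $ (k, b) * y $ (c, d)" for c d
  proof -
    have "c = a \<or> c = a + 1 \<or> c = a + 2"
      using exhaust_3[of a] exhaust_3[of c] by auto
    then show ?thesis
      using k exhaust_2[of b] exhaust_2[of d] rank1 zero by (auto simp: mult_ac)
  qed
  \<comment> \<open>Dividing by the pivot normalises \<open>v $ k\<close> to 1, so that
    \<open>w\<close> is exactly row \<open>k\<close>.\<close>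
  define v where "v = (\<chi> c. y $ (c, b) / y $ (k, b))"
  define w where "w = (\<chi> d. y $ (k, d))"
  have "outer v w = y"
    using y minors by (auto simp: vec_eq_iff outer_def v_def w_def field_simps)
  moreover have "v $ (a + 2) = 0"
    by (simp add: v_def zero)
  then have "v $ 1 * v $ 2 * v $ 3 = 0"
    using exhaust_3[of a] by (auto simp: mod_3)
  moreover have "v $ k \<noteq> 0" "w $ b \<noteq> 0"
    using y by (simp_all add: v_def w_def)
  ultimately show thesis
    using that z_eq by blast
qed

section \<open>Change of charts and the projection to the triangle\<close>

lemma transition_mult_vec: "(transition j k *v w) $ b = (if b = 1 then w $ 1 else twist (j - k) * w $ 2)"
  using exhaust_2[of b] by (auto simp: transition_def matrix_vector_mult_def sum_2)

lemma transition_vec_nonzero: "w \<noteq> 0 \<Longrightarrow> transition j k *v w \<noteq> 0"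
  by (auto simp: vec_eq_iff transition_mult_vec forall_2 twist_nonzero)

text \<open>Row by row: where \<open>v $ a\<close> vanishes both sides are 0, and elsewhere
  \<open>twist_cocycle\<close> applies to \<open>a\<close>, \<open>j\<close>,
  \<open>k\<close>.\<close>

lemma chart_transition:
  assumes v: "v $ 1 * v $ 2 * v $ 3 = 0" "v $ j \<noteq> 0" "v $ k \<noteq> 0"
  shows "chart k (outer v w) = chart j (outer v (transition j k *v w))"
proof -
  have tw: "v $ a = 0 \<or> twist (a - k) = twist (a - j) * twist (j - k)" for a
    using twist_cocycle[OF v(1) _ v(2,3)] by metis
  have "weight k ab * outer v w $ ab = weight j ab * outer v (transition j k *v w) $ ab" for ab
    using tw[of "fst ab"] exhaust_2[of "snd ab"]
    by (cases ab) (auto simp: weight_def outer_nth transition_mult_vec)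
  then show ?thesis
    by (simp add: chart_def vec_eq_iff)
qed

lemma base_point_chart:
  assumes v: "v $ 1 * v $ 2 * v $ 3 = 0" "v $ k \<noteq> 0" and w: "w \<noteq> 0"
  shows "base_point (hpoint (chart k (outer v w))) = hpoint v"
  unfolding base_point_def
proof (rule some_equality)
  show "\<exists>k' v' w'. hpoint v' \<in> corner k' \<and> w' \<noteq> 0 \<and> hpoint v = hpoint v' \<and>
      hpoint (chart k (outer v w)) = hpoint (chart k' (outer v' w'))"
    using assms hpoint_in_corner by blast
next
  fix p
  assume "\<exists>k' v' w'. hpoint v' \<in> corner k' \<and> w' \<noteq> 0 \<and> p = hpoint v' \<and>
      hpoint (chart k (outer v w)) = hpoint (chart k' (outer v' w'))"
  then obtain j v' w' where v': "v' $ 1 * v' $ 2 * v' $ 3 = 0" "v' $ j \<noteq> 0"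
    and p: "p = hpoint v'"
    and eq: "hpoint (chart k (outer v w)) = hpoint (chart j (outer v' w'))"
    by (auto simp: hpoint_in_corner)
  obtain t where t: "chart k (outer v w) = t *s chart j (outer v' w')"
    using self_mem_hpoint[of "chart k (outer v w)"] unfolding eq mem_hpoint by blast
  obtain b where b: "w $ b \<noteq> 0"
    using w by (auto simp: vec_eq_iff)
  \<comment> \<open>The left side is nonzero, which puts \<open>hpoint v'\<close> in corner
    \<open>k\<close> too and allows both presentations to be compared in chart
    \<open>k\<close>.\<close>
  have "weight k (k, b) * (v $ k * w $ b) = t * (weight j (k, b) * (v' $ k * w' $ b))"
    using arg_cong[OF t, of "\<lambda>z. z $ e (k, b)"] by (simp add: chart_nth outer_nth)
  then have "v' $ k \<noteq> 0"
    using v(2) b weight_nonzero[of k "(k, b)"] by auto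
  then have "chart k (outer v w) = t *s chart k (outer v' (transition k j *v w'))"
    using t chart_transition[OF v'(1) _ v'(2)] by simp
  then have "outer v w = t *s outer v' (transition k j *v w')"
    using chart_inv_chart[of k] by (metis chart_scale)
  \<comment> \<open>Column \<open>b\<close> of the two rank one matrices shows \<open>v\<close> and
    \<open>v'\<close> to be proportional.\<close>
  then have "v $ a * w $ b = t * (v' $ a * (transition k j *v w') $ b)" for a
    by (metis outer_nth vector_smult_component)
  then have "v = (t * (transition k j *v w') $ b / w $ b) *s v'" (is "v = ?s *s v'")
    using b by (simp add: vec_eq_iff field_simps)
  moreover from this have "?s \<noteq> 0"
    using v(2) by (metis vector_smult_component mult_zero_left)
  ultimately show "p = hpoint v"
    unfolding p using hpoint_scale by metis
qed

text \<open>The chart is chosen from a nonzero coordinate \<open>e (k, b)\<close>. The column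
  \<open>b\<close> is kept because \<open>regular_base_point\<close> reads the base point off
  it.\<close>

lemma surfaceE:
  assumes "x \<in> surface"
  obtains k b v w where "x = hpoint (chart k (outer v w))"
    "v $ 1 * v $ 2 * v $ 3 = 0" "v $ k \<noteq> 0" "w $ b \<noteq> 0"
proof -
  obtain z where z: "x = hpoint z" "z \<noteq> 0"
    using assms unfolding surface_def by (auto elim: proj_spaceE)
  then have on: "on_surface z"
    using assms by (simp add: hpoint_in_surface)
  then obtain k b where "z $ e (k, b) \<noteq> 0"
    using z(2) unfolding on_surface_def vec_eq_iff by force
  then show thesis
    using chart_surj[OF on] that z(1) by metis
qed

lemma surface_subset: "surface \<subseteq> proj_space"
  by (auto simp: surface_def)

lemma base_point_in_triangle: "x \<in> surface \<Longrightarrow> base_point x \<in> triangle_cubic"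
proof -
  assume "x \<in> surface"
  then obtain k b v w where x: "x = hpoint (chart k (outer v w))"
    and v: "v $ 1 * v $ 2 * v $ 3 = 0" "v $ k \<noteq> 0" and "w $ b \<noteq> 0"
    by (rule surfaceE)
  then have "w \<noteq> 0" "v \<noteq> 0"
    by auto
  then show ?thesis
    using v(1) base_point_chart[OF v] by (simp add: x hpoint_in_triangle_cubic)
qed

text \<open>Where the coordinate \<open>e (k, b)\<close> is nonzero, column \<open>b\<close> of the
  untwisted matrix is a nonzero multiple of the base point, and its entries are linear
  forms.\<close>

lemma regular_base_point: "regular_map surface triangle_cubic base_point"
proof (rule regular_mapI[OF surface_subset base_point_in_triangle])
  fix x assume "x \<in> surface"
  then obtain k b v w where x: "x = hpoint (chart k (outer v w))"
    and v: "v $ 1 * v $ 2 * v $ 3 = 0" "v $ k \<noteq> 0" and w: "w $ b \<noteq> 0"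
    by (rule surfaceE)
  define V where "V = {p \<in> surface. \<forall>z\<in>p. z $ e (k, b) \<noteq> 0}"
  define F where "F a z = inverse (weight k (a, b)) * z $ e (a, b)" for a and z :: "'k ^ 'n"
  have "openin (subtopology zariski surface) V"
    unfolding V_def by (rule openin_coordinate_nonzero[OF surface_subset])
  moreover have "x \<in> V"
    using \<open>x \<in> surface\<close> v w
    by (auto simp: x V_def mem_hpoint chart_nth outer_nth weight_nonzero)
  moreover have "\<forall>a. form 1 (F a)"
    unfolding F_def using form_linear_monomial by blast
  moreover have "(\<chi> a. F a u) \<noteq> 0 \<and> base_point (hpoint u) = hpoint (\<chi> a. F a u)"
    if "hpoint u \<in> V" for u
  proof -
    have "on_surface u" "u $ e (k, b) \<noteq> 0"
      using that self_mem_hpoint[of u] by (auto simp: V_def hpoint_in_surface)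
    then obtain v' w' where u: "u = chart k (outer v' w')"
      and v': "v' $ 1 * v' $ 2 * v' $ 3 = 0" "v' $ k \<noteq> 0" and w': "w' $ b \<noteq> 0"
      by (rule chart_surj)
    have F: "(\<chi> a. F a u) = (w' $ b) *s v'"
      by (simp add: vec_eq_iff F_def u chart_nth outer_nth weight_nonzero mult_ac)
    have "w' \<noteq> 0" "v' \<noteq> 0"
      using v' w' by auto
    then show ?thesis
      unfolding F using w' base_point_chart[OF v'] by (simp add: u hpoint_scale)
  qed
  ultimately show "\<exists>V d F. openin (subtopology zariski surface) V \<and> x \<in> V \<and>
      (\<forall>i. form d (F i)) \<and>
      (\<forall>u. hpoint u \<in> V \<longrightarrow> (\<chi> i. F i u) \<noteq> 0 \<and> base_point (hpoint u) = hpoint (\<chi> i. F i u))"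
    by blast
qed

section \<open>Trivialisations over the corners\<close>

lemma segre_prod_cornerE:
  assumes "q \<in> segre_prod (corner k) proj_space"
  obtains v w where "q = hpoint (outer v w)" "v $ 1 * v $ 2 * v $ 3 = 0" "v $ k \<noteq> 0" "w \<noteq> 0"
proof -
  obtain p r where pr: "q = segre p r" "p \<in> corner k" "r \<in> proj_space"
    using assms by (auto simp: segre_prod_def)
  then show thesis
    using that by (auto elim!: cornerE proj_spaceE simp: segre_hpoint)
qed

lemma hpoint_outer_in_segre_prod:
  assumes "v $ 1 * v $ 2 * v $ 3 = 0" "v $ k \<noteq> 0" "w \<noteq> 0"
  shows "hpoint (outer v w) \<in> segre_prod (corner k) proj_space"
  unfolding segre_prod_def
  using assms segre_hpoint[of v w, symmetric] hpoint_in_corner hpoint_in_proj_space by blast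

lemma chart_hpoint: "chart k ` hpoint y = hpoint (chart k y)"
  by (rule image_hpoint) (rule chart_scale)

lemma chart_inv_hpoint: "chart_inv k ` hpoint z = hpoint (chart_inv k z)"
  by (rule image_hpoint) (rule chart_inv_scale)

text \<open>\<open>surfaceE\<close> may present the point in another chart \<open>j\<close>; the
  transition matrix carries it to chart \<open>k\<close>.\<close>

lemma over_cornerE:
  assumes "x \<in> surface" "base_point x \<in> corner k"
  obtains v w where "x = hpoint (chart k (outer v w))"
    "v $ 1 * v $ 2 * v $ 3 = 0" "v $ k \<noteq> 0" "w \<noteq> 0"
proof -
  obtain j b v w where x: "x = hpoint (chart j (outer v w))"
    and v: "v $ 1 * v $ 2 * v $ 3 = 0" "v $ j \<noteq> 0" and w: "w $ b \<noteq> 0"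
    using assms(1) by (rule surfaceE)
  then have w0: "w \<noteq> 0"
    by auto
  then have "v $ k \<noteq> 0"
    using assms(2) base_point_chart[OF v] by (simp add: x hpoint_in_corner)
  then show thesis
    using that[of v "transition k j *v w"] x v w0 chart_transition[OF v(1) _ v(2)]
      transition_vec_nonzero by simp
qed

lemma regular_iso_chart:
  "regular_iso (segre_prod (corner k) proj_space) {x \<in> surface. base_point x \<in> corner k} ((`) (chart k))"
    (is "regular_iso ?S ?T _")
proof -
  have chart_in: "hpoint (chart k (outer v w)) \<in> ?T"
    if "v $ 1 * v $ 2 * v $ 3 = 0" "v $ k \<noteq> 0" "w \<noteq> 0" for v w
    using that by (auto simp: hpoint_in_surface base_point_chart hpoint_in_corner on_surface_chart
        chart_eq_0_iff outer_eq_0_iff)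
  have S: "?S \<subseteq> proj_space"
    by (auto elim!: segre_prod_cornerE simp: hpoint_in_proj_space outer_eq_0_iff)
  have "regular_map ?S ?T ((`) (chart k))"
  proof (rule regular_map_image[OF S])
    show "chart k ` q \<in> ?T" if q: "q \<in> ?S" for q
    proof -
      obtain v w where q_eq: "q = hpoint (outer v w)"
        and vw: "v $ 1 * v $ 2 * v $ 3 = 0" "v $ k \<noteq> 0" "w \<noteq> 0"
        using q by (rule segre_prod_cornerE)
      show ?thesis
        unfolding q_eq chart_hpoint by (rule chart_in[OF vw])
    qed
    \<comment> \<open>Coordinates outside the range of \<open>e\<close> are given by the zero form,
      taken in degree 1 to match the others.\<close>
    show "form 1 (\<lambda>y. chart k y $ i)" for i
      using form_linear_monomial[of "weight k (inv e i)" "inv e i"]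
        form_linear_monomial[of 0 "inv e i"]
      by (cases "i \<in> range e") (simp_all add: chart_def)
    show "chart k y \<noteq> 0" if "hpoint y \<in> ?S" for y
      using that S by (auto simp: chart_eq_0_iff hpoint_in_proj_space)
  qed (rule chart_scale)
  moreover have "regular_map ?T ?S ((`) (chart_inv k))"
  proof (rule regular_map_image)
    show "chart_inv k ` x \<in> ?S" if "x \<in> ?T" for x
    proof -
      obtain v w where "x = hpoint (chart k (outer v w))"
        "v $ 1 * v $ 2 * v $ 3 = 0" "v $ k \<noteq> 0" "w \<noteq> 0"
        using \<open>x \<in> ?T\<close> by (auto elim: over_cornerE)
      then show ?thesis
        by (simp add: chart_inv_hpoint chart_inv_chart hpoint_outer_in_segre_prod)
    qed
    show "form 1 (\<lambda>z. chart_inv k z $ i)" for i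
      unfolding chart_inv_def using form_linear_monomial by simp
    show "chart_inv k z \<noteq> 0" if "hpoint z \<in> ?T" for z
    proof
      assume "chart_inv k z = 0"
      moreover have "on_surface z" "z \<noteq> 0"
        using that by (simp_all add: hpoint_in_surface)
      \<comment> \<open>\<open>chart_inv\<close> forgets the coordinates outside the range of
        \<open>e\<close>, but these vanish on the surface, so \<open>z\<close> would be 0.\<close>
      ultimately show False
        using chart_chart_inv chart_eq_0_iff unfolding on_surface_def by metis
    qed
  qed (use surface_subset in \<open>auto simp: chart_inv_scale\<close>)
  moreover have "\<forall>q\<in>?S. chart_inv k ` chart k ` q = q"
    by (simp add: image_image chart_inv_chart)
  moreover have "\<forall>x\<in>?T. chart k ` chart_inv k ` x = x"
  proof
    fix x assume "x \<in> ?T"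
    then obtain v w where x: "x = hpoint (chart k (outer v w))"
      by (auto elim: over_cornerE)
    show "chart k ` chart_inv k ` x = x"
      unfolding x chart_inv_hpoint chart_inv_chart chart_hpoint ..
  qed
  ultimately show ?thesis
    unfolding regular_iso_def by blast
qed

section \<open>Gluing into a projective bundle\<close>

lemma transition_cocycle:
  assumes "v $ 1 * v $ 2 * v $ 3 = (0 :: 'k)" "v $ i \<noteq> 0" "v $ j \<noteq> 0" "v $ k \<noteq> 0"
  shows "transition i j ** transition j k = transition i k"
  using twist_cocycle[OF assms]
  by (simp add: transition_def matrix_matrix_mult_def vec_eq_iff forall_2 sum_2)

lemma vector_bundle_transition:
  "vector_bundle triangle_cubic {1, 2, 3} (\<lambda>i. corner (of_nat i))
     (\<lambda>i j p. transition (of_nat i) (of_nat j))"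
  unfolding vector_bundle_def
proof (intro conjI ballI allI)
  show "openin (subtopology zariski triangle_cubic) (corner (of_nat i))" for i
    unfolding corner_def
    by (rule openin_coordinate_nonzero) (auto simp: triangle_cubic_def)
  show "(\<Union>i\<in>{1, 2, 3}. corner (of_nat i)) = triangle_cubic"
    by (simp add: Union_corner)
  show "regular_function (corner (of_nat i) \<inter> corner (of_nat j))
      (\<lambda>p. transition (of_nat i) (of_nat j) $ a $ b)" for i j a b
    using corner_subset(2) by (intro regular_function_const) blast
  show "transition (of_nat i) (of_nat i) = mat 1" for i
    by (simp add: transition_def mat_def vec_eq_iff twist_def)
  fix i j k p
  assume "p \<in> corner (of_nat i) \<inter> corner (of_nat j) \<inter> corner (of_nat k)"
  then have p: "p \<in> corner (of_nat i)" "p \<in> corner (of_nat j)" "p \<in> corner (of_nat k)"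
    by simp_all
  from p(1) obtain v where v: "p = hpoint v" "v $ 1 * v $ 2 * v $ 3 = 0" "v $ of_nat i \<noteq> 0"
    by (rule cornerE)
  then have "v $ of_nat j \<noteq> 0" "v $ of_nat k \<noteq> 0"
    using p(2,3) by (simp_all add: hpoint_in_corner)
  then show "transition (of_nat i) (of_nat j) ** transition (of_nat j) (of_nat k) =
      transition (of_nat i) (of_nat k)"
    by (rule transition_cocycle[OF v(2,3)])
qed

lemma projective_bundle_surface:
  "is_projective_bundle surface base_point triangle_cubic {1, 2, 3} (\<lambda>i. corner (of_nat i))
     (\<lambda>i j p. transition (of_nat i) (of_nat j))"
  unfolding is_projective_bundle_def
proof (intro conjI regular_base_point exI[of _ "\<lambda>i. (`) (chart (of_nat i))"] ballI allI impI)
  show "regular_iso (segre_prod (corner (of_nat i)) proj_space)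
      {x \<in> surface. base_point x \<in> corner (of_nat i)} ((`) (chart (of_nat i)))" for i
    by (rule regular_iso_chart)
  show "base_point (chart (of_nat i) ` segre p q) = p"
    if "p \<in> corner (of_nat i)" "q \<in> proj_space" for i p q
  proof -
    obtain v where v: "p = hpoint v" "v $ 1 * v $ 2 * v $ 3 = 0" "v $ of_nat i \<noteq> 0"
      using \<open>p \<in> corner (of_nat i)\<close> by (rule cornerE)
    obtain w where w: "w \<noteq> 0" "q = hpoint w"
      using \<open>q \<in> proj_space\<close> by (rule proj_spaceE)
    show ?thesis
      unfolding v(1) w(2) segre_hpoint chart_hpoint by (rule base_point_chart[OF v(2,3) w(1)])
  qed
  show "chart (of_nat j) ` segre p (hpoint w) =
      chart (of_nat i) ` segre p (hpoint (transition (of_nat i) (of_nat j) *v w))"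
    if p: "p \<in> corner (of_nat i) \<inter> corner (of_nat j)" for i j p w
  proof -
    from p have "p \<in> corner (of_nat i)"
      by simp
    then obtain v where v: "p = hpoint v" "v $ 1 * v $ 2 * v $ 3 = 0" "v $ of_nat i \<noteq> 0"
      by (rule cornerE)
    then have "v $ of_nat j \<noteq> 0"
      using p by (simp add: hpoint_in_corner)
    then show ?thesis
      unfolding v(1) segre_hpoint chart_hpoint using chart_transition[OF v(2,3)] by simp
  qed
qed

lemma ruled_surface: "ruled_surface_over surface triangle_cubic"
  unfolding ruled_surface_over_def
  using vector_bundle_transition projective_bundle_surface by blast

end


section \<open>The pieces of the Pfaffian locus\<close>

text \<open>The vectors \<open>u\<close> and \<open>w\<close> list the two columns of surviving
  coordinates by vertex, and clearing denominators in \<open>lam\<close> gives the equations with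
  \<open>c1\<close> and \<open>c2\<close>.\<close>

lemma ruled_surface_cycle:
  fixes u w :: "('n::finite) ^ 3" and c1 c2 :: "'k::field"
  assumes c: "c1 \<noteq> 0" "c2 \<noteq> 0" and d: "distinct [u $ 1, u $ 2, u $ 3, w $ 1, w $ 2, w $ 3]"
    and X: "X = {p \<in> proj_space. \<forall>z\<in>p.
      (\<forall>i. i \<notin> {u $ 1, u $ 2, u $ 3, w $ 1, w $ 2, w $ 3} \<longrightarrow> z $ i = 0) \<and>
      (z $ (u $ 3) = 0 \<and> z $ (w $ 3) = 0 \<and> c2\<^sup>2 * z $ (u $ 1) * z $ (w $ 2) = c1\<^sup>2 * z $ (w $ 1) * z $ (u $ 2) \<or>
       z $ (u $ 1) = 0 \<and> z $ (w $ 1) = 0 \<and> c2\<^sup>2 * z $ (u $ 2) * z $ (w $ 3) = c1\<^sup>2 * z $ (w $ 2) * z $ (u $ 3) \<or>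
       z $ (u $ 2) = 0 \<and> z $ (w $ 2) = 0 \<and> c2\<^sup>2 * z $ (u $ 3) * z $ (w $ 1) = c1\<^sup>2 * z $ (w $ 3) * z $ (u $ 1))}"
  shows "ruled_surface_over X triangle_cubic"
proof -
  define e where "e ab = (if snd ab = 1 then u $ fst ab else w $ fst ab)" for ab :: "3 \<times> 2"
  define lam where "lam = c1\<^sup>2 / c2\<^sup>2"
  have "inj e"
  proof (rule injI)
    fix x y assume "e x = e y"
    then show "x = y"
      using d exhaust_3[of "fst x"] exhaust_3[of "fst y"] exhaust_2[of "snd x"] exhaust_2[of "snd y"]
      by (cases x; cases y) (auto simp: e_def)
  qed
  then interpret quadric_triangle e lam
    using c by unfold_locales (auto simp: lam_def)
  have "range e = {e (1, 1), e (2, 1), e (3, 1), e (1, 2), e (2, 2), e (3, 2)}"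
  proof (intro subset_antisym subsetI)
    fix i assume "i \<in> range e"
    then obtain a b where "i = e (a, b)"
      by auto
    then show "i \<in> {e (1, 1), e (2, 1), e (3, 1), e (1, 2), e (2, 2), e (3, 2)}"
      using exhaust_3[of a] exhaust_2[of b] by auto
  qed auto
  then have range_e: "range e = {u $ 1, u $ 2, u $ 3, w $ 1, w $ 2, w $ 3}"
    by (simp add: e_def)
  have lam: "x * y = lam * x' * y' \<longleftrightarrow> c2\<^sup>2 * x * y = c1\<^sup>2 * x' * y'" for x y x' y'
    using c by (auto simp: lam_def field_simps)
  have ex: "(\<exists>a. P a) \<longleftrightarrow> P 1 \<or> P 2 \<or> P 3" for P :: "3 \<Rightarrow> bool"
    by (metis exhaust_3)
  have "X = surface"
    unfolding X surface_def on_surface_def range_e lam ex by (simp add: e_def mod_3)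
  then show ?thesis
    using ruled_surface by simp
qed

lemma forall_9:
  "(\<forall>i::9. P i) \<longleftrightarrow> P 1 \<and> P 2 \<and> P 3 \<and> P 4 \<and> P 5 \<and> P 6 \<and> P 7 \<and> P 8 \<and> P 9"
proof -
  have "i = 1 \<or> i = 2 \<or> i = 3 \<or> i = 4 \<or> i = 5 \<or> i = 6 \<or> i = 7 \<or> i = 8 \<or> i = 9" for i :: 9
  proof (induct i)
    case (of_int z)
    then have "0 \<le> z" "z < 9"
      by simp_all
    \<comment> \<open>The residue 0 is the index 9.\<close>
    then have "z = 0 \<or> z = 1 \<or> z = 2 \<or> z = 3 \<or> z = 4 \<or> z = 5 \<or> z = 6 \<or> z = 7 \<or> z = 8"
      by arith
    then show ?case
      by auto
  qed
  then show ?thesis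
    by metis
qed

theorem theorem4p12:
  fixes c1 c2 :: "'k::alg_closed_field"
  assumes "CHAR('k) \<noteq> 2" and "CHAR('k) \<noteq> 3"
    and "c1 * c2 * (c1 ^ 6 - c2 ^ 6) \<noteq> 0"
  shows "ruled_surface_over (X1 c1 c2) triangle_cubic \<and>
         ruled_surface_over (X2 c1 c2) triangle_cubic \<and>
         ruled_surface_over (X3 c1 c2) triangle_cubic"
proof -
  note c = coeff_nonzero[OF assms(3)]
  \<comment> \<open>The three pieces differ only by relabelling: \<open>A\<close> stands for the
    linear equations of a piece and \<open>D\<close> for its three quadrics.\<close>
  have "ruled_surface_over {p \<in> pfaffian_locus c1 c2. \<forall>z\<in>p. A z} triangle_cubic"
    if pf: "\<And>z. A z \<Longrightarrow>
        (\<forall>xs\<in>set (subseqs [1..<10]). length xs = 6 \<longrightarrow> pf (skew_matrix c1 c2 z) xs = 0) \<longleftrightarrow> D z"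
      and d: "distinct [u $ 1, u $ 2, u $ 3, w $ 1, w $ 2, w $ 3]"
      and A: "\<And>z. A z \<longleftrightarrow> (\<forall>i. i \<notin> {u $ 1, u $ 2, u $ 3, w $ 1, w $ 2, w $ 3} \<longrightarrow> z $ i = 0)"
      and D: "\<And>z. D z \<longleftrightarrow>
        z $ (u $ 3) = 0 \<and> z $ (w $ 3) = 0 \<and>
          c2\<^sup>2 * z $ (u $ 1) * z $ (w $ 2) = c1\<^sup>2 * z $ (w $ 1) * z $ (u $ 2) \<or>
        z $ (u $ 1) = 0 \<and> z $ (w $ 1) = 0 \<and>
          c2\<^sup>2 * z $ (u $ 2) * z $ (w $ 3) = c1\<^sup>2 * z $ (w $ 2) * z $ (u $ 3) \<or>
        z $ (u $ 2) = 0 \<and> z $ (w $ 2) = 0 \<and>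
          c2\<^sup>2 * z $ (u $ 3) * z $ (w $ 1) = c1\<^sup>2 * z $ (w $ 3) * z $ (u $ 1)"
    for A D :: "'k ^ 9 \<Rightarrow> bool" and u w :: "9 ^ 3"
  proof -
    have "{p \<in> pfaffian_locus c1 c2. \<forall>z\<in>p. A z} = {p \<in> proj_space. \<forall>z\<in>p. A z \<and> D z}"
      unfolding pfaffian_locus_def using pf by blast
    then show ?thesis
      unfolding A D using ruled_surface_cycle[OF c(1,2) d refl] by (rule ssubst)
  qed
  note piece = this
  show ?thesis
    unfolding X1_def X2_def X3_def
  proof (intro conjI)
    show "ruled_surface_over {p \<in> pfaffian_locus c1 c2. \<forall>z\<in>p. z $ 1 = 0 \<and> z $ 6 = 0 \<and> z $ 8 = 0}
        triangle_cubic"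
      \<comment> \<open>The pairs (4, 3), (9, 5), (2, 7) are those that vanish together on one of
        the quadrics; they are ordered so that the quadrics follow the cycle. The index permutation
        carries these vectors to those of the third piece when applied once and of the second when
        applied twice.\<close>
      by (rule piece[where u = "vector [4, 9, 2]" and w = "vector [3, 5, 7]",
            OF pfaffians_vanish_X1[OF c(1-3)]])
        (auto simp: forall_9 mult_ac)
    show "ruled_surface_over {p \<in> pfaffian_locus c1 c2. \<forall>z\<in>p. z $ 3 = 0 \<and> z $ 5 = 0 \<and> z $ 7 = 0}
        triangle_cubic"
      by (rule piece[where u = "vector [6, 8, 1]" and w = "vector [2, 4, 9]",
            OF pfaffians_vanish_X2[OF c(1-3)]])
        (auto simp: forall_9 mult_ac)
    show "ruled_surface_over {p \<in> pfaffian_locus c1 c2. \<forall>z\<in>p. z $ 2 = 0 \<and> z $ 4 = 0 \<and> z $ 9 = 0}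
        triangle_cubic"
      by (rule piece[where u = "vector [5, 7, 3]" and w = "vector [1, 6, 8]",
            OF pfaffians_vanish_X3[OF c(1-3)]])
        (auto simp: forall_9 mult_ac)
  qed
qed

end
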